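(* Let $p,q\ge 1$ be integers, let $Q\in\mathbb{R}^{p\times p}$ and $R\in\mathbb{R}^{q\times q}$ be symmetric positive definite matrices, and let $A_\star\in\mathbb{R}^{p\times p}$, $B_\star\in\mathbb{R}^{p\times q}$ be such that the pair $(A_\star,B_\star)$ is stabilizable. Let $D_\star=A_\star+B_\star L(A_\star,B_\star)$, where $L(\cdot,\cdot)$ is the Riccati feedback matrix defined in the context, and assume that $\overline{\lambda}(D_\star)\le -1$. Then there is a constant $c>0$ (which may depend on $A_\star,B_\star,Q,R$) such that for all $A\in\mathbb{R}^{p\times p}$ and $B\in\mathbb{R}^{p\times q}$ satisfying $$\|A-A_\star\|\le -c\,\overline{\lambda}(D_\star)\,p^{-1/2}$$ and $$\|B-B_\star\|\le -c\,\overline{\lambda}(D_\star)\,p^{-1/2}\,\|L(A_\star,B_\star)\|^{-1},$$ the matrix $L(A,B)$ is well defined and $$\overline{\lambda}\bigl(A_\star+B_\star L(A,B)\bigr)<0.$$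
   Context: For a square matrix $M$, $\overline{\lambda}(M)$ denotes the largest real part of the (complex) eigenvalues of $M$. For vectors, $\|\cdot\|$ is the Euclidean norm; for matrices, $\|M\|=\sup_{\|v\|=1}\|Mv\|$ is the operator norm. A pair $(A,B)\in\mathbb{R}^{p\times p}\times\mathbb{R}^{p\times q}$ is stabilizable if there exists $L_{\mathrm{stab}}\in\mathbb{R}^{q\times p}$ with $\overline{\lambda}(A+BL_{\mathrm{stab}})<0$. With $Q\in\mathbb{R}^{p\times p}$, $R\in\mathbb{R}^{q\times q}$ fixed symmetric positive definite matrices, define for $M\in\mathbb{R}^{p\times p}$ $$\Phi_{A,B}(M)=A^\top M+MA-MBR^{-1}B^\top M+Q.$$ When $(A,B)$ is stabilizable, the algebraic Riccati equation $\Phi_{A,B}(M)=0$ has a unique (symmetric) positive semidefinite solution, denoted $K(A,B)$, and one defines the feedback matrix $$L(A,B)=-R^{-1}B^\top K(A,B)\in\mathbb{R}^{q\times p}.$$ $L(A,B)$ is called well defined if the equation $\Phi_{A,B}(M)=0$ has a unique symmetric positive semidefinite solution. If $L(A_\star,B_\star)=0$, the bound involving $\|L(A_\star,B_\star)\|^{-1}$ is read as imposing no restriction (right-hand side $+\infty$). *)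

theory Defs
  imports "HOL-Analysis.Analysis"
begin

text \<open>
  A \<open>p \<times> q\<close> real matrix is an element of \<^typ>\<open>real^'q^'p\<close>, with \<open>p = CARD('p)\<close> and
  \<open>q = CARD('q)\<close>.
\<close>

definition complex_eigenvalue :: "real^'n^'n \<Rightarrow> complex \<Rightarrow> bool" where
  "complex_eigenvalue M z \<longleftrightarrow>
     (\<exists>v :: complex^'n. v \<noteq> 0 \<and> map_matrix complex_of_real M *v v = z *s v)"

definition lambda_bar :: "real^'n^'n \<Rightarrow> real" where
  "lambda_bar M = Max {Re z | z. complex_eigenvalue M z}"

text \<open>
  The library's \<^const>\<open>onorm\<close> is the supremum of \<open>norm (M *v x) / norm x\<close> over all \<open>x\<close>.
  This is the operator norm; the \<^const>\<open>norm\<close> on the matrix type is the Frobenius norm.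
\<close>
definition op_norm :: "real^'n^'m \<Rightarrow> real" where
  "op_norm M = onorm (\<lambda>x. M *v x)"

definition sym_pos_def :: "real^'n^'n \<Rightarrow> bool" where
  "sym_pos_def M \<longleftrightarrow> transpose M = M \<and> (\<forall>x. x \<noteq> 0 \<longrightarrow> x \<bullet> (M *v x) > 0)"

definition sym_pos_semidef :: "real^'n^'n \<Rightarrow> bool" where
  "sym_pos_semidef M \<longleftrightarrow> transpose M = M \<and> (\<forall>x. x \<bullet> (M *v x) \<ge> 0)"

definition stabilizable :: "real^'p^'p \<Rightarrow> real^'q^'p \<Rightarrow> bool" where
  "stabilizable A B \<longleftrightarrow> (\<exists>L :: real^'p^'q. lambda_bar (A + B ** L) < 0)"

definition riccati_map ::
  "real^'p^'p \<Rightarrow> real^'q^'q \<Rightarrow> real^'p^'p \<Rightarrow> real^'q^'p \<Rightarrow> real^'p^'p \<Rightarrow> real^'p^'p" where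
  "riccati_map Q R A B M =
     transpose A ** M + M ** A - M ** B ** matrix_inv R ** transpose B ** M + Q"

text \<open>
  \<open>riccati_sol\<close> and \<open>feedback\<close> are meaningful only when \<open>feedback_well_defined\<close> holds.
\<close>
definition feedback_well_defined ::
  "real^'p^'p \<Rightarrow> real^'q^'q \<Rightarrow> real^'p^'p \<Rightarrow> real^'q^'p \<Rightarrow> bool" where
  "feedback_well_defined Q R A B \<longleftrightarrow>
     (\<exists>!M. sym_pos_semidef M \<and> riccati_map Q R A B M = 0)"

definition riccati_sol ::
  "real^'p^'p \<Rightarrow> real^'q^'q \<Rightarrow> real^'p^'p \<Rightarrow> real^'q^'p \<Rightarrow> real^'p^'p" where
  "riccati_sol Q R A B = (THE M. sym_pos_semidef M \<and> riccati_map Q R A B M = 0)"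

definition feedback ::
  "real^'p^'p \<Rightarrow> real^'q^'q \<Rightarrow> real^'p^'p \<Rightarrow> real^'q^'p \<Rightarrow> real^'p^'q" where
  "feedback Q R A B = - (matrix_inv R ** transpose B ** riccati_sol Q R A B)"

end

theory Submission
  imports Defs "HOL-Computational_Algebra.Fundamental_Theorem_Algebra"
begin

text \<open>
  A matrix \<open>D\<close> is stable iff some positive definite \<open>K\<close> makes \<open>v \<bullet> (K *v v)\<close> strictly decreasing
  along \<open>D\<close>; only the passage from eigenvalues to \<open>K\<close> needs spectral arguments, and it is used
  once, for the stabilizability hypothesis. Everything else is a comparison of quadratic forms:
  if \<open>D\<close> has such a \<open>K\<close>, then any symmetric form that does not increase along \<open>D\<close> is positive
  semidefinite.

  The Riccati equation is solved by a form of least trace among the positive semidefinite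
  solutions of the Riccati inequality: a Newton (Kleinman) step stays in this set and decreases
  the form, so it fixes the minimiser.

  Let \<open>K\<^sub>*\<close> be the solution for the true system and \<open>L\<^sub>*\<close> its feedback. For \<open>(A, B)\<close> nearby, \<open>K\<^sub>*\<close>
  is still a Lyapunov form for \<open>A + B L\<^sub>*\<close>, so \<open>L(A, B)\<close> is well defined, and comparing along
  \<open>A + B L\<^sub>*\<close> gives \<open>K(A, B) \<le> 2 K\<^sub>*\<close>. This uniform bound makes \<open>K(A, B)\<close> a Lyapunov form for
  \<open>A\<^sub>* + B\<^sub>* L(A, B)\<close>. If \<open>L\<^sub>* = 0\<close>, then \<open>B\<close> is unrestricted, but \<open>K\<^sub>*\<close> is a Lyapunov form for
  \<open>A\<^sub>* + B\<^sub>* L\<close> whatever \<open>L\<close> is.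
\<close>

section \<open>Positive semidefinite matrices and comparison of forms\<close>

lemma inner_matrix_vector_transpose:
  fixes M :: "real^'n^'m"
  shows "x \<bullet> (M *v y) = (transpose M *v x) \<bullet> y"
  by (simp add: dot_lmul_matrix)

lemma inner_symmetric_matrix:
  fixes M :: "real^'n^'n"
  assumes "transpose M = M"
  shows "x \<bullet> (M *v y) = (M *v x) \<bullet> y"
  using inner_matrix_vector_transpose[of x M y] assms by simp

lemma quadratic_form_add:
  fixes M :: "real^'n^'n"
  assumes "transpose M = M"
  shows "(x + y) \<bullet> (M *v (x + y)) = x \<bullet> (M *v x) + 2 * (x \<bullet> (M *v y)) + y \<bullet> (M *v y)"
  using inner_symmetric_matrix[OF assms, of y x]
  by (simp add: inner_add_left inner_add_right matrix_vector_right_distrib inner_commute)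

text \<open>Moving from \<open>v\<close> along \<open>- (M *v v)\<close> changes the form by a
  negative first-order and a nonnegative second-order term, so a zero value would become negative
  after a small step.\<close>

lemma psd_kernel:
  fixes M :: "real^'n^'n"
  assumes M: "sym_pos_semidef M" and v: "v \<bullet> (M *v v) = 0"
  shows "M *v v = 0"
proof (rule ccontr)
  assume nz: "M *v v \<noteq> 0"
  define w where "w = M *v v"
  define a where "a = w \<bullet> w"
  define b where "b = w \<bullet> (M *v w)"
  have sym: "transpose M = M" and psd: "\<And>x. x \<bullet> (M *v x) \<ge> 0"
    using M by (auto simp: sym_pos_semidef_def)
  have a: "a > 0" using nz by (simp add: a_def w_def)
  have b: "b \<ge> 0" using psd by (simp add: b_def)
  have q: "- (2 * s * a) + s\<^sup>2 * b \<ge> 0" for s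
  proof -
    have "v \<bullet> (M *v w) = a"
      using inner_symmetric_matrix[OF sym, of v w] by (simp add: a_def w_def)
    moreover have "w \<bullet> (M *v v) = a" by (simp add: a_def w_def)
    ultimately show ?thesis
      using psd[of "v + (- s) *\<^sub>R w"] v quadratic_form_add[OF sym, of v "(- s) *\<^sub>R w"]
      unfolding matrix_vector_mult_scaleR by (simp add: b_def power2_eq_square)
  qed
  \<comment> \<open>Small enough for the linear term to dominate, since \<open>s * b\<close> is at
    most \<open>a\<close>; the \<open>+ 1\<close> covers \<open>b = 0\<close>.\<close>
  define s where "s = a / (b + 1)"
  have s: "s > 0" using a b by (simp add: s_def)
  have "s * b \<le> a" using a b unfolding s_def by (simp add: field_simps)
  then have "s * b < 2 * a" using a by simp
  then have "s * (s * b) < s * (2 * a)" using s by (rule mult_strict_left_mono)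
  then show False using q[of s] by (simp add: power2_eq_square)
qed

lemma sym_pos_def_semidef: "sym_pos_def M \<Longrightarrow> sym_pos_semidef M"
  unfolding sym_pos_def_def sym_pos_semidef_def by (metis inner_zero_left order_less_imp_le order_refl)

text \<open>By \<open>psd_kernel\<close>, definiteness of a semidefinite form can be checked on its
  kernel; Lyapunov forms are recognised this way below.\<close>

lemma sym_pos_def_iff_kernel:
  "sym_pos_def M \<longleftrightarrow> sym_pos_semidef M \<and> (\<forall>v. M *v v = 0 \<longrightarrow> v = 0)"
proof (intro iffI conjI allI impI)
  fix v assume "sym_pos_def M" and "M *v v = 0"
  then show "v = 0" by (metis inner_zero_right order_less_irrefl sym_pos_def_def)
next
  assume M: "sym_pos_semidef M \<and> (\<forall>v. M *v v = 0 \<longrightarrow> v = 0)"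
  then have "x \<bullet> (M *v x) > 0" if "x \<noteq> 0" for x
    using psd_kernel[of M x] that unfolding sym_pos_semidef_def by (metis less_eq_real_def)
  then show "sym_pos_def M" using M by (simp add: sym_pos_def_def sym_pos_semidef_def)
qed (rule sym_pos_def_semidef)

lemma continuous_on_quadratic_form [continuous_intros]:
  fixes M :: "real^'n^'n"
  shows "continuous_on S (\<lambda>x. x \<bullet> (M *v x))"
  by (intro continuous_intros linear_continuous_on_compose matrix_vector_mul_linear)

text \<open>The form attains a positive minimum on the unit sphere, and homogeneity carries this
  bound to all vectors.\<close>

lemma sym_pos_def_coercive:
  fixes M :: "real^'n^'n"
  assumes "sym_pos_def M"
  obtains d where "d > 0" "\<And>x. d * (norm x)\<^sup>2 \<le> x \<bullet> (M *v x)"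
proof -
  have "compact (sphere (0::real^'n) 1)" "sphere (0::real^'n) 1 \<noteq> {}" by auto
  from continuous_attains_inf[OF this continuous_on_quadratic_form[of _ M]]
  obtain u where u: "norm u = 1" and min: "\<And>x. norm x = 1 \<Longrightarrow> u \<bullet> (M *v u) \<le> x \<bullet> (M *v x)"
    by auto
  show ?thesis
  proof
    have "u \<noteq> 0" using u by auto
    then show "u \<bullet> (M *v u) > 0" using assms unfolding sym_pos_def_def by blast
    show "(u \<bullet> (M *v u)) * (norm x)\<^sup>2 \<le> x \<bullet> (M *v x)" for x
    proof (cases "x = 0")
      case False
      have "u \<bullet> (M *v u) \<le> (x /\<^sub>R norm x) \<bullet> (M *v (x /\<^sub>R norm x))"
        using min[of "x /\<^sub>R norm x"] False by simp
      also have "\<dots> = (x \<bullet> (M *v x)) / (norm x)\<^sup>2"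
        by (simp add: matrix_vector_mult_scaleR power2_eq_square field_simps)
      finally show ?thesis using False by (simp add: field_simps)
    qed auto
  qed
qed

text \<open>The quantity required to be negative is half the derivative of
  \<open>v \<bullet> (K *v v)\<close> along the flow of \<open>D\<close>.\<close>

definition lyapunov :: "real^'n^'n \<Rightarrow> real^'n^'n \<Rightarrow> bool" where
  "lyapunov K D \<longleftrightarrow> sym_pos_def K \<and> (\<forall>v. v \<noteq> 0 \<longrightarrow> v \<bullet> (K *v (D *v v)) < 0)"

text \<open>Let \<open>u\<close> minimise the ratio of the two forms. Then
  \<open>K - r u *\<^sub>R K0\<close> is semidefinite and vanishes at \<open>u\<close>, so
  \<open>K *v u\<close> is \<open>r u\<close> times \<open>K0 *v u\<close>, and the decay rates
  along \<open>D\<close> at \<open>u\<close> have the same ratio. One rate is nonpositive and the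
  other negative, hence \<open>r u\<close> is nonnegative.\<close>

lemma lyapunov_comparison:
  fixes K0 K D :: "real^'n^'n"
  assumes K0: "lyapunov K0 D" and sym: "transpose K = K"
    and le: "\<And>v. v \<bullet> (K *v (D *v v)) \<le> 0"
  shows "sym_pos_semidef K"
proof -
  have pd: "sym_pos_def K0" and neg: "\<And>v. v \<noteq> 0 \<Longrightarrow> v \<bullet> (K0 *v (D *v v)) < 0"
    using K0 by (auto simp: lyapunov_def)
  have pos: "\<And>v. v \<noteq> 0 \<Longrightarrow> v \<bullet> (K0 *v v) > 0" and sym0: "transpose K0 = K0"
    using pd by (auto simp: sym_pos_def_def)
  define r where "r v = (v \<bullet> (K *v v)) / (v \<bullet> (K0 *v v))" for v
  have "compact (sphere (0::real^'n) 1)" "sphere (0::real^'n) 1 \<noteq> {}" by auto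
  moreover have "v \<bullet> (K0 *v v) \<noteq> 0" if "v \<in> sphere 0 1" for v
    using pos[of v] that by (cases "v = 0") auto
  then have "continuous_on (sphere 0 1) r"
    unfolding r_def by (intro continuous_intros) auto
  ultimately obtain u where u: "norm u = 1" and min: "\<And>x. norm x = 1 \<Longrightarrow> r u \<le> r x"
    using continuous_attains_inf[of "sphere 0 1" r] by auto
  have u0: "u \<noteq> 0" using u by auto
  define E where "E = K - r u *\<^sub>R K0"
  have E: "E *v x = K *v x - r u *\<^sub>R (K0 *v x)" for x
    by (simp add: E_def matrix_vector_mult_diff_rdistrib scaleR_matrix_vector_assoc)
  have "x \<bullet> (E *v x) \<ge> 0" for x
  proof (cases "x = 0")
    case False
    have "r u \<le> r (x /\<^sub>R norm x)" using min[of "x /\<^sub>R norm x"] False by simp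
    also have "\<dots> = r x" using False by (simp add: r_def matrix_vector_mult_scaleR field_simps)
    finally show ?thesis using pos[OF False] by (simp add: E r_def field_simps inner_diff_right)
  qed auto
  moreover have "transpose E = E"
    using sym sym0 by (simp add: E_def transpose_def vec_eq_iff)
  ultimately have "sym_pos_semidef E" by (simp add: sym_pos_semidef_def)
  moreover have "u \<bullet> (E *v u) = 0"
    using pos[OF u0] by (simp add: E r_def inner_diff_right)
  ultimately have "E *v u = 0" by (rule psd_kernel)
  then have Ku: "K *v u = r u *\<^sub>R (K0 *v u)" by (simp add: E)
  have "u \<bullet> (K *v (D *v u)) = r u * (u \<bullet> (K0 *v (D *v u)))"
    by (simp add: inner_symmetric_matrix[OF sym] inner_symmetric_matrix[OF sym0] Ku)
  then have ru: "r u \<ge> 0"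
    using le[of u] neg[OF u0] by (metis mult_less_0_iff mult_neg_neg not_less)
  have "x \<bullet> (K *v x) \<ge> 0" for x
  proof (cases "x = 0")
    case False
    have "0 \<le> x \<bullet> (E *v x)" by fact
    moreover have "0 \<le> r u * (x \<bullet> (K0 *v x))" using ru pos[OF False] by simp
    ultimately show ?thesis by (simp add: E inner_diff_right)
  qed auto
  then show ?thesis using sym by (simp add: sym_pos_semidef_def)
qed

section \<open>Entries and norm of a semidefinite matrix are controlled by its trace\<close>

lemma abs_entry_le_diagonal:
  fixes M :: "real^'n^'n"
  assumes "sym_pos_semidef M"
  shows "\<bar>M $ i $ j\<bar> \<le> (M $ i $ i + M $ j $ j) / 2"
proof -
  have sym: "transpose M = M" and psd: "\<And>x. x \<bullet> (M *v x) \<ge> 0"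
    using assms by (auto simp: sym_pos_semidef_def)
  have e: "axis k 1 \<bullet> (M *v axis l 1) = M $ k $ l" for k l
    by (simp add: inner_axis' matrix_vector_mul_component inner_axis)
  have "0 \<le> M $ i $ i + 2 * (s * M $ i $ j) + s\<^sup>2 * M $ j $ j" for s
    using psd[of "axis i 1 + s *\<^sub>R axis j 1"] quadratic_form_add[OF sym, of "axis i 1" "s *\<^sub>R axis j 1"]
    by (simp add: e matrix_vector_mult_scaleR power2_eq_square)
  \<comment> \<open>The two values of \<open>s\<close> bound the off-diagonal entry from below and
    from above.\<close>
  from this[of 1] this[of "-1"] show ?thesis by simp
qed

lemma diagonal_nonneg:
  fixes M :: "real^'n^'n"
  assumes "sym_pos_semidef M"
  shows "M $ i $ i \<ge> 0"
  using abs_entry_le_diagonal[OF assms, of i i] by auto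

lemma abs_entry_le_trace:
  fixes M :: "real^'n^'n"
  assumes "sym_pos_semidef M"
  shows "\<bar>M $ i $ j\<bar> \<le> trace M"
proof -
  have "M $ k $ k \<le> trace M" for k
    unfolding trace_def by (rule member_le_sum) (use diagonal_nonneg[OF assms] in auto)
  from this[of i] this[of j] show ?thesis using abs_entry_le_diagonal[OF assms, of i j] by (simp add: field_simps)
qed

lemma trace_nonneg:
  fixes M :: "real^'n^'n"
  assumes "sym_pos_semidef M"
  shows "trace M \<ge> 0"
  using abs_entry_le_trace[OF assms] by (meson abs_ge_zero order_trans)

text \<open>Makes sets of semidefinite matrices with bounded trace bounded, as the compactness
  argument for the Riccati equation requires.\<close>

lemma norm_le_trace:
  fixes M :: "real^'n^'n"
  assumes "sym_pos_semidef M"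
  shows "norm M \<le> real CARD('n) * (real CARD('n) * trace M)"
proof -
  have "norm (M $ i) \<le> real CARD('n) * trace M" for i
  proof -
    have "norm (M $ i) \<le> (\<Sum>j\<in>UNIV. \<bar>M $ i $ j\<bar>)" by (rule norm_le_l1_cart)
    also have "\<dots> \<le> (\<Sum>j\<in>(UNIV::'n set). trace M)"
      by (intro sum_mono abs_entry_le_trace assms)
    finally show ?thesis by simp
  qed
  then have "(\<Sum>i\<in>UNIV. norm (M $ i)) \<le> (\<Sum>i\<in>(UNIV::'n set). real CARD('n) * trace M)"
    by (intro sum_mono)
  moreover have "norm M \<le> (\<Sum>i\<in>UNIV. norm (M $ i))"
    unfolding norm_vec_def by (rule L2_set_le_sum) auto
  ultimately show ?thesis by simp
qed

lemma symmetric_eq_zeroI: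
  fixes M :: "real^'n^'n"
  assumes sym: "transpose M = M" and z: "\<And>v. v \<bullet> (M *v v) = 0"
  shows "M = 0"
proof -
  have "M *v v = 0" for v
    using psd_kernel[of M v] sym z by (simp add: sym_pos_semidef_def)
  then show ?thesis by (simp add: matrix_eq)
qed

section \<open>The Lyapunov equation\<close>

lemma matrix_vector_mult_diff_scaleR:
  fixes A B :: "real^'n^'m"
  shows "(A - r *\<^sub>R B) *v x = A *v x - r *\<^sub>R (B *v x)"
  by (simp add: matrix_vector_mult_diff_rdistrib scaleR_matrix_vector_assoc)

lemma matrix_vector_mult_minus_left:
  fixes A :: "real^'n^'m"
  shows "(- A) *v x = - (A *v x)"
  using matrix_vector_mult_diff_rdistrib[of 0 A x] by simp

lemma transpose_add: "transpose (A + B) = transpose A + transpose B"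
  by (simp add: transpose_def vec_eq_iff)

lemma transpose_uminus: "transpose (- A) = - transpose A"
  by (simp add: transpose_def vec_eq_iff)

lemma linear_matrix_mult_right: "linear (\<lambda>X. X ** (A :: real^'n^'m))"
  by (rule linearI) (simp_all add: matrix_eq matrix_vector_mul_assoc[symmetric]
      matrix_vector_mult_add_rdistrib scaleR_matrix_vector_assoc[symmetric])

lemma linear_matrix_mult_left: "linear (\<lambda>X. (A :: real^'n^'m) ** X)"
  by (rule linearI) (simp_all add: matrix_add_ldistrib matrix_scalar_ac scalar_matrix_assoc)

lemma linear_transpose: "linear (transpose :: real^'n^'m \<Rightarrow> real^'m^'n)"
  by (rule linearI) (simp_all add: transpose_add transpose_scalar)

text \<open>Symmetry of \<open>K\<close> makes the two summands contribute equally; this passes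
  between the matrix equation and the decay of the form.\<close>

lemma quadratic_form_lyapunov_operator:
  fixes D K :: "real^'n^'n"
  assumes "transpose K = K"
  shows "v \<bullet> ((transpose D ** K + K ** D) *v v) = 2 * (v \<bullet> (K *v (D *v v)))"
proof -
  have "v \<bullet> (transpose D *v (K *v v)) = (D *v v) \<bullet> (K *v v)"
    using inner_matrix_vector_transpose[of v "transpose D" "K *v v"] by simp
  also have "\<dots> = v \<bullet> (K *v (D *v v))"
    using inner_symmetric_matrix[OF assms, of v "D *v v"] by (simp add: inner_commute)
  finally show ?thesis
    by (simp add: matrix_vector_mult_add_rdistrib matrix_vector_mul_assoc[symmetric] inner_add_right
        del: transpose_matrix_vector)
qed

lemma transpose_lyapunov_operator:
  fixes D K :: "real^'n^'n"
  assumes "transpose K = K"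
  shows "transpose (transpose D ** K + K ** D) = transpose D ** K + K ** D"
  by (simp add: transpose_add matrix_transpose_mul assms add.commute)

text \<open>A symmetric solution of the homogeneous equation and its negative are both semidefinite
  by \<open>lyapunov_comparison\<close>, hence zero. So the linear operator is injective, and in
  finite dimension surjective.\<close>

lemma lyapunov_equation:
  fixes K0 D P :: "real^'n^'n"
  assumes K0: "lyapunov K0 D" and P: "transpose P = P"
  obtains K where "transpose K = K" "\<And>v. 2 * (v \<bullet> (K *v (D *v v))) = v \<bullet> (P *v v)"
proof -
  define S where "S X = (1/2) *\<^sub>R (X + transpose X)" for X :: "real^'n^'n"
  \<comment> \<open>The antisymmetric part is added to make the operator injective on all matrices.\<close>
  define f where "f X = (transpose D ** S X + S X ** D) + (X - transpose X)" for X
  have S_sym: "transpose (S X) = S X" for X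
    by (simp add: S_def transpose_add transpose_scalar add.commute)
  have lin_S: "linear S"
    unfolding S_def by (intro linear_compose_scale_right linear_compose_add linear_ident linear_transpose)
  have "linear f" unfolding f_def
    by (intro linear_compose_add linear_compose_sub linear_ident linear_transpose
        linear_compose[OF lin_S linear_matrix_mult_left, unfolded o_def]
        linear_compose[OF lin_S linear_matrix_mult_right, unfolded o_def])
  \<comment> \<open>Comparing \<open>f X = W\<close> with its transpose isolates the antisymmetric
    part, which vanishes because \<open>W\<close> is symmetric.\<close>
  have parts: "transpose D ** S X + S X ** D = W \<and> X = transpose X"
    if fX: "f X = W" and W: "transpose W = W" for X W
  proof -
    define T where "T = transpose D ** S X + S X ** D"
    have T: "transpose T = T" unfolding T_def by (rule transpose_lyapunov_operator[OF S_sym])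
    have 1: "T + (X - transpose X) = W" using fX by (simp add: f_def T_def)
    have "transpose (T + (X - transpose X)) = W" using 1 W by simp
    then have "T + (transpose X - X) = W"
      using T transpose_add[of X "- transpose X"] by (simp add: transpose_add transpose_uminus)
    with 1 have "X - transpose X = transpose X - X" by (metis add_left_cancel)
    then have "(X - transpose X) + (X - transpose X) = 0" by simp
    then have "2 *\<^sub>R (X - transpose X) = 0" by (simp only: scaleR_2)
    then have "X = transpose X" by simp
    then show ?thesis using 1 by (simp add: T_def)
  qed
  have "inj f" unfolding linear_injective_0[OF \<open>linear f\<close>]
  proof (intro allI impI)
    fix X assume "f X = 0"
    with parts[of X 0] have z: "transpose D ** S X + S X ** D = 0" and sym: "X = transpose X"
      by (auto simp: transpose_def vec_eq_iff zero_vec_def)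
    have SX: "S X = X" using sym by (simp add: S_def scaleR_2[symmetric])
    have q: "v \<bullet> (X *v (D *v v)) = 0" for v
      using quadratic_form_lyapunov_operator[of X v D] z sym SX by simp
    have "sym_pos_semidef X"
      by (rule lyapunov_comparison[OF K0]) (use q sym in auto)
    moreover have "sym_pos_semidef (- X)"
      by (rule lyapunov_comparison[OF K0])
        (use q sym transpose_uminus[of X] in \<open>auto simp: matrix_vector_mult_minus_left\<close>)
    ultimately have "v \<bullet> (X *v v) = 0" for v
      unfolding sym_pos_semidef_def
      by (metis inner_minus_right matrix_vector_mult_minus_left neg_0_le_iff_le order_antisym)
    then show "X = 0" by (rule symmetric_eq_zeroI[OF sym[symmetric]])
  qed
  then have "surj f" using linear_injective_imp_surjective[OF \<open>linear f\<close>] by simp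
  then obtain X where "f X = P" by (metis surjD)
  from parts[OF this P] have z: "transpose D ** S X + S X ** D = P" by simp
  show thesis
    by (rule that[OF S_sym])
      (use z quadratic_form_lyapunov_operator[OF S_sym, of _ D X] in simp)
qed

text \<open>By compactness the form decays at a rate proportional to the squared norm of
  \<open>v\<close>, so a small change of \<open>D\<close> cannot cancel it and the same
  \<open>K\<close> still works.\<close>

lemma lyapunov_perturb:
  fixes K D :: "real^'n^'n"
  assumes "lyapunov K D"
  obtains e where "e > 0" "\<And>D'. (\<And>v. norm (D' *v v - D *v v) \<le> e * norm v) \<Longrightarrow> lyapunov K D'"
proof -
  have pd: "sym_pos_def K" and sym: "transpose K = K"
    using assms by (auto simp: lyapunov_def sym_pos_def_def)
  define W where "W = - (transpose D ** K + K ** D)"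
  have qW: "v \<bullet> (W *v v) = - 2 * (v \<bullet> (K *v (D *v v)))" for v
    using quadratic_form_lyapunov_operator[OF sym, of v D]
    unfolding W_def matrix_vector_mult_minus_left by simp
  have "transpose W = W"
    unfolding W_def transpose_uminus transpose_lyapunov_operator[OF sym] ..
  then have "sym_pos_def W"
    using assms qW by (simp add: sym_pos_def_def lyapunov_def)
  then obtain d where d: "d > 0" "\<And>x. d * (norm x)\<^sup>2 \<le> x \<bullet> (W *v x)"
    using sym_pos_def_coercive by blast
  define N where "N = onorm ((*v) K)"
  have N: "norm (K *v x) \<le> N * norm x" for x
    unfolding N_def by (rule onorm) simp
  have N0: "N \<ge> 0" unfolding N_def by (rule onorm_pos_le) simp
  \<comment> \<open>The decay margin is \<open>d / 2\<close>; this \<open>e\<close> lets the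
    perturbation use up at most \<open>d / 4\<close>.\<close>
  define e where "e = d / (4 * (N + 1))"
  have e: "e > 0" using d N0 by (simp add: e_def)
  show thesis
  proof (rule that[OF e])
    fix D' assume D': "\<And>v. norm (D' *v v - D *v v) \<le> e * norm v"
    have "v \<bullet> (K *v (D' *v v)) < 0" if "v \<noteq> 0" for v
    proof -
      have "v \<bullet> (K *v (D' *v v)) = v \<bullet> (K *v (D *v v)) + v \<bullet> (K *v (D' *v v - D *v v))"
        by (simp add: matrix_vector_mult_diff_distrib inner_diff_right)
      also have "v \<bullet> (K *v (D *v v)) \<le> - d * (norm v)\<^sup>2 / 2" using d(2)[of v] qW[of v] by simp
      also have "v \<bullet> (K *v (D' *v v - D *v v)) \<le> norm v * (N * (e * norm v))"
        by (rule order_trans[OF norm_cauchy_schwarz])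
          (intro mult_left_mono order_trans[OF N] D' N0 norm_ge_zero)
      also have "\<dots> = (N * e) * (norm v)\<^sup>2" by (simp add: power2_eq_square)
      also have "\<dots> \<le> d / 4 * (norm v)\<^sup>2"
        by (rule mult_right_mono) (use d N0 in \<open>auto simp: e_def field_simps\<close>)
      finally have "v \<bullet> (K *v (D' *v v)) \<le> - (d / 4 * (norm v)\<^sup>2)" by simp
      also have "\<dots> < 0" using d that by simp
      finally show ?thesis .
    qed
    then show "lyapunov K D'" using pd by (simp add: lyapunov_def)
  qed
qed

section \<open>Eigenvalues of real matrices\<close>

text \<open>One more iterate than the dimension forces a linear relation. It is applied both to the
  orbit of a vector and to the powers of a matrix, with complex spaces viewed as real ones.\<close>

lemma iterate_annihilator:
  fixes f :: "'a::euclidean_space \<Rightarrow> 'a"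
  shows "\<exists>p :: real poly. p \<noteq> 0 \<and> (\<Sum>i\<le>degree p. coeff p i *\<^sub>R (f ^^ i) x) = 0"
proof -
  define N where "N = DIM('a)"
  define g where "g i = (f ^^ i) x" for i
  obtain c :: "nat \<Rightarrow> real" where c: "\<exists>i\<le>N. c i \<noteq> 0" and z: "(\<Sum>i\<le>N. c i *\<^sub>R g i) = 0"
  proof (cases "inj_on g {..N}")
    case True
    then have "card (g ` {..N}) > DIM('a)" by (simp add: card_image N_def)
    then have "dependent (g ` {..N})" by (intro dependent_biggerset) auto
    then obtain u where u: "\<exists>v\<in>g ` {..N}. u v \<noteq> 0" "(\<Sum>v\<in>g ` {..N}. u v *\<^sub>R v) = 0"
      by (auto simp: real_vector.dependent_finite)
    show thesis
      by (rule that[of "\<lambda>i. u (g i)"]) (use u sum.reindex[OF True, of "\<lambda>v. u v *\<^sub>R v"] in auto)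
  next
    case False
    then obtain i j where ij: "i \<le> N" "j \<le> N" "i \<noteq> j" "g i = g j" by (auto simp: inj_on_def)
    define c where "c k = (if k = i then 1 else 0) - (if k = j then 1 else (0::real))" for k
    have "(\<Sum>k\<le>N. c k *\<^sub>R g k)
        = (\<Sum>k\<le>N. if k = i then g k else 0) - (\<Sum>k\<le>N. if k = j then g k else 0)"
      by (subst sum_subtractf[symmetric]) (auto simp: c_def intro!: sum.cong)
    also have "\<dots> = 0" using ij by simp
    finally show thesis using ij by (intro that[of c]) (auto simp: c_def intro!: exI[of _ i])
  qed
  define p where "p = (\<Sum>i\<le>N. monom (c i) i)"
  have cf: "coeff p k = (if k \<le> N then c k else 0)" for k
    by (simp add: p_def coeff_sum)
  show ?thesis
  proof (intro exI conjI)
    show "p \<noteq> 0" using c cf by (metis coeff_0)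
    have "degree p \<le> N" by (intro degree_le) (simp add: cf)
    then have "(\<Sum>i\<le>degree p. coeff p i *\<^sub>R g i) = (\<Sum>i\<le>N. coeff p i *\<^sub>R g i)"
      by (intro sum.mono_neutral_left) (auto simp: coeff_eq_0)
    also have "\<dots> = 0" using z by (simp add: cf)
    finally show "(\<Sum>i\<le>degree p. coeff p i *\<^sub>R (f ^^ i) x) = 0" by (simp add: g_def)
  qed
qed

lemma degree_linear_factor_mult:
  "q \<noteq> 0 \<Longrightarrow> degree ([:- a, 1:] * q) = Suc (degree q)" for a :: "'a::idom"
  using degree_mult_eq[of "[:- a, 1:]" q] by (simp del: mult_pCons_left)

text \<open>This is the identity \<open>((X - a) q)(M) w = q(M) (M w - a w)\<close>: a root can be
  split off an annihilating polynomial at the price of changing the vector.\<close>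

lemma root_shift_polynomial_action:
  fixes M :: "complex^'n^'n" and q :: "complex poly"
  shows "(\<Sum>i\<le>degree ([:- a, 1:] * q). coeff ([:- a, 1:] * q) i *s ((*v) M ^^ i) w)
    = (\<Sum>i\<le>degree q. coeff q i *s ((*v) M ^^ i) (M *v w - a *s w))"
proof (cases "q = 0")
  case False
  define N where "N = degree q"
  define m where "m i u = ((*v) M ^^ i) u" for i u
  have m_Suc: "m i (M *v u) = m (Suc i) u" for i u
    by (simp add: m_def funpow_Suc_right del: funpow.simps)
  have m_diff: "m i (u - a *s u') = m i u - a *s m i u'" for i u u'
    by (induction i) (simp_all add: m_def matrix_vector_mult_diff_distrib vector_scalar_commute)
  have deg: "degree ([:- a, 1:] * q) = Suc N" using False by (simp only: degree_linear_factor_mult N_def not_False_eq_True)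
  have cf: "coeff ([:- a, 1:] * q) 0 = - a * coeff q 0"
    "\<And>i. coeff ([:- a, 1:] * q) (Suc i) = coeff q i - a * coeff q (Suc i)" by simp_all
  have top: "coeff q (Suc N) = 0" by (simp add: N_def coeff_eq_0)
  have "(\<Sum>i\<le>Suc N. coeff ([:- a, 1:] * q) i *s m i w)
      = (- a * coeff q 0) *s m 0 w + (\<Sum>i\<le>N. (coeff q i - a * coeff q (Suc i)) *s m (Suc i) w)"
    unfolding sum.atMost_Suc_shift cf ..
  also have "\<dots> = (\<Sum>i\<le>N. coeff q i *s m (Suc i) w)
      - a *s (coeff q 0 *s m 0 w + (\<Sum>i\<le>N. coeff q (Suc i) *s m (Suc i) w))"
    by (simp add: vec.scale_left_diff_distrib vec.scale_right_distrib sum_subtractf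
        vec.scale_sum_right vec.scale_minus_left)
  also have "coeff q 0 *s m 0 w + (\<Sum>i\<le>N. coeff q (Suc i) *s m (Suc i) w)
      = (\<Sum>i\<le>Suc N. coeff q i *s m i w)"
    unfolding sum.atMost_Suc_shift ..
  also have "\<dots> = (\<Sum>i\<le>N. coeff q i *s m i w)" by (simp add: top)
  also have "(\<Sum>i\<le>N. coeff q i *s m (Suc i) w) - a *s (\<Sum>i\<le>N. coeff q i *s m i w)
      = (\<Sum>i\<le>N. coeff q i *s m i (M *v w - a *s w))"
    by (simp add: m_diff m_Suc vec.scale_right_diff_distrib sum_subtractf vec.scale_sum_right mult.commute)
  finally show ?thesis unfolding deg N_def[symmetric] m_def .
qed simp

text \<open>Induction on the degree of a polynomial annihilating \<open>w\<close>: for a root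
  \<open>a\<close>, either \<open>w\<close> is an eigenvector, or \<open>M *v w - a *s w\<close> is
  a nonzero vector of \<open>W\<close> annihilated by the quotient. The subspace is kept so that
  eigenvectors can be found in the range of a given matrix.\<close>

lemma invariant_subspace_eigenvector:
  fixes M :: "complex^'n^'n"
  assumes W: "vec.subspace W" and inv: "\<And>v. v \<in> W \<Longrightarrow> M *v v \<in> W" and w: "w \<in> W" "w \<noteq> 0"
  obtains z v where "v \<in> W" "v \<noteq> 0" "M *v v = z *s v"
proof -
  have ex: "\<exists>z v. v \<in> W \<and> v \<noteq> 0 \<and> M *v v = z *s v"
    if "p \<noteq> 0" "(\<Sum>i\<le>degree p. coeff p i *s ((*v) M ^^ i) w) = 0" "w \<in> W" "w \<noteq> 0"
    for p :: "complex poly" and w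
    using that
  proof (induction "degree p" arbitrary: p w)
    case 0
    then have "coeff p 0 \<noteq> 0" by (metis leading_coeff_0_iff)
    with 0 show ?case by simp
  next
    case (Suc n)
    then have "\<not> constant (poly p)" by (simp add: constant_degree)
    then obtain a where "poly p a = 0" using fundamental_theorem_of_algebra by blast
    then obtain q where p: "p = [:- a, 1:] * q" by (metis dvdE poly_eq_0_iff_dvd)
    with Suc.prems have q: "q \<noteq> 0" by auto
    then have dq: "n = degree q" using Suc.hyps(2) unfolding p degree_linear_factor_mult[OF q] by simp
    show ?case
    proof (cases "M *v w = a *s w")
      case False
      show ?thesis
      proof (rule Suc.hyps(1)[OF dq q])
        show "(\<Sum>i\<le>degree q. coeff q i *s ((*v) M ^^ i) (M *v w - a *s w)) = 0"
          using Suc.prems(2) unfolding p root_shift_polynomial_action .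
        show "M *v w - a *s w \<in> W"
          using W inv Suc.prems(3) by (intro vec.subspace_diff vec.subspace_scale) auto
      qed (use False in simp)
    qed (use Suc.prems in blast)
  qed
  obtain p :: "real poly" where p: "p \<noteq> 0" "(\<Sum>i\<le>degree p. coeff p i *\<^sub>R ((*v) M ^^ i) w) = 0"
    using iterate_annihilator[of "(*v) M" w] by auto
  have "complex_of_real r *s u = r *\<^sub>R u" for r and u :: "complex^'n"
    by (simp add: vec_eq_iff scaleR_conv_of_real[symmetric])
  then have "(\<Sum>i\<le>degree (map_poly complex_of_real p).
      coeff (map_poly complex_of_real p) i *s ((*v) M ^^ i) w) = 0"
    using p(2) by (simp add: coeff_map_poly degree_map_poly)
  from ex[OF _ this w] p(1) that show thesis by (auto simp: map_poly_eq_0_iff)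
qed

lemma complex_eigenvalue_exists: "\<exists>z. complex_eigenvalue (M :: real^'n^'n) z"
proof -
  obtain z and v :: "complex^'n" where "v \<noteq> 0" "map_matrix complex_of_real M *v v = z *s v"
    by (rule invariant_subspace_eigenvector[of UNIV _ "axis undefined 1"]) auto
  then show ?thesis unfolding complex_eigenvalue_def by blast
qed

text \<open>Every eigenvalue is a root of a nonzero polynomial annihilating the matrix. Finiteness
  makes the \<open>Max\<close> in \<open>lambda_bar\<close> a genuine maximum.\<close>

lemma finite_complex_eigenvalues: "finite {z. complex_eigenvalue (M :: real^'n^'n) z}"
proof -
  define C where "C = map_matrix complex_of_real M"
  define g where "g = (\<lambda>A :: complex^'n^'n. C ** A)"
  obtain p where p: "p \<noteq> 0" "(\<Sum>i\<le>degree p. coeff p i *\<^sub>R (g ^^ i) (mat 1)) = 0"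
    using iterate_annihilator[of g "mat 1"] by blast
  have "poly (map_poly complex_of_real p) z = 0" if ev: "complex_eigenvalue M z" for z
  proof -
    obtain v where v: "v \<noteq> 0" "C *v v = z *s v"
      using ev unfolding complex_eigenvalue_def C_def by blast
    have pow: "(g ^^ i) (mat 1) *v v = z ^ i *s v" for i
      by (induction i) (simp_all add: g_def matrix_vector_mul_assoc[symmetric] vector_scalar_commute v(2) mult.commute)
    have lin: "linear (\<lambda>A :: complex^'n^'n. A *v v)"
      by (rule linearI)
        (simp_all add: matrix_vector_mult_def vec_eq_iff scaleR_sum_right distrib_right sum.distrib)
    have "0 = (\<Sum>i\<le>degree p. coeff p i *\<^sub>R (g ^^ i) (mat 1)) *v v" using p(2) by simp
    also have "\<dots> = (\<Sum>i\<le>degree p. coeff p i *\<^sub>R ((g ^^ i) (mat 1) *v v))"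
      by (simp add: linear_sum[OF lin] linear_scale[OF lin])
    also have "\<dots> = poly (map_poly complex_of_real p) z *s v"
      by (simp add: pow poly_altdef coeff_map_poly degree_map_poly vec_eq_iff sum_distrib_right
          scaleR_conv_of_real[where 'a = complex] mult.assoc)
    finally show ?thesis using v(1) by simp
  qed
  then have "{z. complex_eigenvalue M z} \<subseteq> {z. poly (map_poly complex_of_real p) z = 0}" by blast
  moreover have "finite {z. poly (map_poly complex_of_real p) z = 0}"
    using p(1) by (intro poly_roots_finite) (simp add: map_poly_eq_0_iff)
  ultimately show ?thesis by (rule finite_subset)
qed

lemma lambda_bar_less_iff: "lambda_bar M < r \<longleftrightarrow> (\<forall>z. complex_eigenvalue M z \<longrightarrow> Re z < r)"
proof -
  have "{Re z | z. complex_eigenvalue M z} = Re ` {z. complex_eigenvalue M z}" by auto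
  then have "finite {Re z | z. complex_eigenvalue M z}" "{Re z | z. complex_eigenvalue M z} \<noteq> {}"
    using finite_complex_eigenvalues[of M] complex_eigenvalue_exists[of M] by auto
  then show ?thesis unfolding lambda_bar_def by (auto simp: Max_less_iff)
qed

section \<open>Complex eigenvectors as pairs of real vectors\<close>

definition complex_vec :: "real^'n \<Rightarrow> real^'n \<Rightarrow> complex^'n" where
  "complex_vec a b = (\<chi> i. Complex (a $ i) (b $ i))"

lemma complex_vec_surj: obtains a b where "v = complex_vec a b"
  by (rule that[of "\<chi> i. Re (v $ i)" "\<chi> i. Im (v $ i)"]) (simp add: complex_vec_def vec_eq_iff)

lemma complex_vec_eq_iff: "complex_vec a b = complex_vec c d \<longleftrightarrow> a = c \<and> b = d"
  by (auto simp: complex_vec_def vec_eq_iff)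

lemma complex_vec_eq_0_iff: "complex_vec a b = 0 \<longleftrightarrow> a = 0 \<and> b = 0"
  by (auto simp: complex_vec_def vec_eq_iff complex_eq_iff)

lemma complex_vec_add: "complex_vec a b + complex_vec c d = complex_vec (a + c) (b + d)"
  by (simp add: complex_vec_def vec_eq_iff complex_eq_iff)

lemma scale_complex_vec:
  "z *s complex_vec a b = complex_vec (Re z *\<^sub>R a - Im z *\<^sub>R b) (Im z *\<^sub>R a + Re z *\<^sub>R b)"
  by (simp add: complex_vec_def vec_eq_iff complex_eq_iff)

lemma real_matrix_complex_vec:
  "map_matrix complex_of_real M *v complex_vec a b = complex_vec (M *v a) (M *v b)"
  by (simp add: complex_vec_def vec_eq_iff complex_eq_iff matrix_vector_mult_def)

text \<open>Splits the eigenvalue equation into real and imaginary parts, to which real quadratic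
  forms can be applied.\<close>

lemma complex_eigenvalue_real_form:
  "complex_eigenvalue M z \<longleftrightarrow> (\<exists>a b. (a \<noteq> 0 \<or> b \<noteq> 0) \<and>
     M *v a = Re z *\<^sub>R a - Im z *\<^sub>R b \<and> M *v b = Im z *\<^sub>R a + Re z *\<^sub>R b)"
proof -
  have "complex_eigenvalue M z \<longleftrightarrow> (\<exists>a b. complex_vec a b \<noteq> 0 \<and>
      map_matrix complex_of_real M *v complex_vec a b = z *s complex_vec a b)"
    unfolding complex_eigenvalue_def by (metis complex_vec_surj)
  then show ?thesis
    by (auto simp: real_matrix_complex_vec scale_complex_vec complex_vec_eq_iff complex_vec_eq_0_iff)
qed

text \<open>The determinant makes invariance of the eigenvalues under transposition
  immediate.\<close>

lemma complex_eigenvalue_iff_det: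
  fixes M :: "real^'n^'n"
  shows "complex_eigenvalue M z \<longleftrightarrow> det (map_matrix complex_of_real M - mat z) = 0"
proof -
  have "mat z *v v = z *s v" for v :: "complex^'n"
    by (simp add: vec_eq_iff matrix_vector_mult_def mat_def if_distrib if_distribR cong: if_cong)
  then have "(map_matrix complex_of_real M - mat z) *v v = 0
      \<longleftrightarrow> map_matrix complex_of_real M *v v = z *s v" for v
    by (simp only: matrix_vector_mult_diff_rdistrib right_minus_eq)
  then have "complex_eigenvalue M z
      \<longleftrightarrow> \<not> (\<exists>B. B ** (map_matrix complex_of_real M - mat z) = mat 1)"
    unfolding complex_eigenvalue_def matrix_left_invertible_ker by auto
  then show ?thesis
    using invertible_det_nz[of "map_matrix complex_of_real M - mat z"]
    unfolding invertible_left_inverse by blast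
qed

lemma complex_eigenvalue_transpose:
  "complex_eigenvalue (transpose M) z \<longleftrightarrow> complex_eigenvalue M z"
proof -
  have "map_matrix complex_of_real (transpose M) - mat z
      = transpose (map_matrix complex_of_real M - mat z)"
    by (auto simp: vec_eq_iff transpose_def mat_def)
  then show ?thesis by (simp add: complex_eigenvalue_iff_det det_transpose)
qed

text \<open>Adding the decay of the form at the real and imaginary parts of an eigenvector cancels
  the \<open>Im z\<close> terms by symmetry of \<open>K\<close>; what remains is \<open>Re z\<close>
  times a positive number.\<close>

lemma lyapunov_lambda_bar:
  assumes "lyapunov K D"
  shows "lambda_bar D < 0"
  unfolding lambda_bar_less_iff
proof (intro allI impI)
  fix z assume "complex_eigenvalue D z"
  then obtain a b where ab: "a \<noteq> 0 \<or> b \<noteq> 0"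
    and D: "D *v a = Re z *\<^sub>R a - Im z *\<^sub>R b" "D *v b = Im z *\<^sub>R a + Re z *\<^sub>R b"
    unfolding complex_eigenvalue_real_form by blast
  have sym: "transpose K = K" and pos: "\<And>v. v \<noteq> 0 \<Longrightarrow> v \<bullet> (K *v v) > 0"
    and neg: "\<And>v. v \<noteq> 0 \<Longrightarrow> v \<bullet> (K *v (D *v v)) < 0"
    using assms by (auto simp: lyapunov_def sym_pos_def_def)
  have "a \<bullet> (K *v (D *v a)) + b \<bullet> (K *v (D *v b)) = Re z * (a \<bullet> (K *v a) + b \<bullet> (K *v b))"
    unfolding D matrix_vector_mult_diff_distrib matrix_vector_right_distrib
      matrix_vector_mult_scaleR inner_diff_right inner_add_right inner_scaleR_right
      inner_symmetric_matrix[OF sym, of b a] inner_commute[of "K *v b" a]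
    by (simp add: distrib_left)
  moreover have "a \<bullet> (K *v (D *v a)) + b \<bullet> (K *v (D *v b)) < 0"
    using ab neg[of a] neg[of b] by (cases "a = 0"; cases "b = 0") auto
  moreover have "a \<bullet> (K *v a) + b \<bullet> (K *v b) > 0"
    using ab pos[of a] pos[of b] by (cases "a = 0"; cases "b = 0") auto
  ultimately show "Re z < 0" by (metis mult_less_0_iff not_less_iff_gr_or_eq)
qed

section \<open>Stable matrices have Lyapunov forms\<close>

text \<open>The hypothesis gives \<open>transpose D ** X = - (X ** D)\<close>, so the range of
  \<open>X\<close> is invariant under \<open>transpose D\<close> and contains an eigenvector after
  complexification. Pairing it with a preimage under \<open>X\<close> shows that the eigenvalue is
  imaginary.\<close>

lemma psd_skew_imp_imaginary_eigenvalue: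
  fixes X D :: "real^'n^'n"
  assumes X: "sym_pos_semidef X" "X \<noteq> 0" and skew: "\<And>v. v \<bullet> (X *v (D *v v)) = 0"
  obtains z where "complex_eigenvalue D z" "Re z = 0"
proof -
  have sym: "transpose X = X" and psd: "\<And>v. v \<bullet> (X *v v) \<ge> 0"
    using X(1) by (auto simp: sym_pos_semidef_def)
  have "transpose D ** X + X ** D = 0"
    by (rule symmetric_eq_zeroI[OF transpose_lyapunov_operator[OF sym]])
      (simp add: quadratic_form_lyapunov_operator[OF sym] skew)
  then have "transpose D ** X = - (X ** D)" by (simp add: eq_neg_iff_add_eq_0)
  then have DX: "transpose D *v (X *v a) = X *v (- (D *v a))" for a
    using matrix_vector_mult_diff_distrib[of X 0 "D *v a"]
    by (simp add: matrix_vector_mul_assoc matrix_vector_mult_minus_left del: transpose_matrix_vector)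
  define M where "M = map_matrix complex_of_real (transpose D)"
  define W where "W = {complex_vec (X *v a) (X *v b) | a b. True}"
  have WI: "complex_vec (X *v a) (X *v b) \<in> W" for a b by (auto simp: W_def)
  have "vec.subspace W"
  proof (rule vec.subspaceI)
    show "0 \<in> W" using WI[of 0 0] complex_vec_eq_0_iff[of "0 :: real^'n" 0] by simp
  next
    fix x y assume "x \<in> W" "y \<in> W"
    then obtain a b c d where "x = complex_vec (X *v a) (X *v b)" "y = complex_vec (X *v c) (X *v d)"
      unfolding W_def by blast
    then show "x + y \<in> W"
      using WI[of "a + c" "b + d"] by (simp add: complex_vec_add matrix_vector_right_distrib)
  next
    fix c x assume "x \<in> W"
    then obtain a b where "x = complex_vec (X *v a) (X *v b)" unfolding W_def by blast
    then show "c *s x \<in> W"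
      using WI[of "Re c *\<^sub>R a - Im c *\<^sub>R b" "Im c *\<^sub>R a + Re c *\<^sub>R b"]
      by (simp add: scale_complex_vec matrix_vector_right_distrib matrix_vector_mult_diff_distrib
          matrix_vector_mult_scaleR)
  qed
  moreover have "M *v v \<in> W" if vW: "v \<in> W" for v
  proof -
    from vW obtain a b where "v = complex_vec (X *v a) (X *v b)" unfolding W_def by blast
    then show ?thesis
      by (simp add: M_def real_matrix_complex_vec DX WI del: transpose_matrix_vector)
  qed
  moreover obtain u where "X *v u \<noteq> 0" using X(2) by (auto simp: matrix_eq)
  then have "complex_vec (X *v u) (X *v 0) \<noteq> 0" by (simp add: complex_vec_eq_0_iff)
  ultimately obtain z v where v: "v \<in> W" "v \<noteq> 0" "M *v v = z *s v"
    using invariant_subspace_eigenvector[of W M] WI by metis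
  from v(1) obtain a b where ab: "v = complex_vec (X *v a) (X *v b)" unfolding W_def by blast
  have nz: "X *v a \<noteq> 0 \<or> X *v b \<noteq> 0" using v(2) by (simp add: ab complex_vec_eq_0_iff)
  have e: "X *v (- (D *v a)) = Re z *\<^sub>R (X *v a) - Im z *\<^sub>R (X *v b)"
    "X *v (- (D *v b)) = Im z *\<^sub>R (X *v a) + Re z *\<^sub>R (X *v b)"
    using v(3) by (simp_all add: ab M_def real_matrix_complex_vec scale_complex_vec complex_vec_eq_iff DX
        del: transpose_matrix_vector)
  have zero: "x \<bullet> (X *v (- (D *v x))) = 0" for x
    using skew[of x] matrix_vector_mult_diff_distrib[of X 0 "D *v x"] by simp
  have "a \<bullet> (X *v b) = b \<bullet> (X *v a)"
    using inner_symmetric_matrix[OF sym, of a b] by (simp add: inner_commute)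
  \<comment> \<open>The two eigenvalue equations are paired with \<open>a\<close> and
    \<open>b\<close>; the \<open>Im z\<close> terms cancel by symmetry of \<open>X\<close>.\<close>
  then have "Re z * (a \<bullet> (X *v a) + b \<bullet> (X *v b))
      = a \<bullet> (X *v (- (D *v a))) + b \<bullet> (X *v (- (D *v b)))"
    unfolding e by (simp add: inner_diff_right inner_add_right distrib_left)
  then have "Re z * (a \<bullet> (X *v a) + b \<bullet> (X *v b)) = 0" by (simp add: zero)
  moreover have "a \<bullet> (X *v a) + b \<bullet> (X *v b) > 0"
  proof -
    have "a \<bullet> (X *v a) \<noteq> 0 \<or> b \<bullet> (X *v b) \<noteq> 0" using nz psd_kernel[OF X(1)] by blast
    then show ?thesis using psd[of a] psd[of b] by linarith
  qed
  ultimately have "Re z = 0" by simp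
  moreover have "complex_eigenvalue (transpose D) z"
    using v(2,3) unfolding complex_eigenvalue_def M_def by blast
  then have "complex_eigenvalue D z" by (simp add: complex_eigenvalue_transpose)
  ultimately show thesis using that by blast
qed

lemma complex_eigenvalue_shift:
  fixes D :: "real^'n^'n"
  assumes "complex_eigenvalue (D - t *\<^sub>R mat 1) z"
  shows "complex_eigenvalue D (z + of_real t)"
proof -
  have "(D - t *\<^sub>R mat 1) *v v = D *v v - t *\<^sub>R v" for v
    by (simp add: matrix_vector_mult_diff_scaleR)
  then show ?thesis
    using assms unfolding complex_eigenvalue_real_form by (simp add: algebra_simps)
qed

lemma linear_matrix_apply: "linear (\<lambda>K :: real^'n^'m. K *v v)"
  by (rule linearI) (simp_all add: matrix_vector_mult_add_rdistrib scaleR_matrix_vector_assoc)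

text \<open>Continuation in the shift \<open>t\<close>: a large shift of \<open>D\<close> has a
  Lyapunov form, the admissible shifts up to \<open>T\<close> form a compact set, and by
  \<open>lyapunov_perturb\<close> a positive least element could be decreased further. So the shift
  \<open>0\<close> is admissible.\<close>

lemma lambda_bar_imp_lyapunov:
  fixes D :: "real^'n^'n"
  assumes "lambda_bar D < 0"
  shows "\<exists>K. lyapunov K D"
proof -
  define E where "E t = D - t *\<^sub>R mat 1" for t
  have E: "E t *v v = D *v v - t *\<^sub>R v" for t v
    by (simp add: E_def matrix_vector_mult_diff_scaleR)
  define S where "S = {t. 0 \<le> t \<and> (\<exists>K. lyapunov K (E t))}"
  \<comment> \<open>The shift exceeds the operator norm, so the identity is a Lyapunov form for
    \<open>E T\<close>.\<close>
  define T where "T = onorm ((*v) D) + 1"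
  have "lyapunov (mat 1) (E T)"
    unfolding lyapunov_def
  proof (intro conjI allI impI)
    show "sym_pos_def (mat 1 :: real^'n^'n)" by (simp add: sym_pos_def_def)
    fix v :: "real^'n" assume "v \<noteq> 0"
    have "v \<bullet> (D *v v) \<le> norm v * (onorm ((*v) D) * norm v)"
      by (rule order_trans[OF norm_cauchy_schwarz]) (intro mult_left_mono onorm, auto)
    also have "\<dots> = onorm ((*v) D) * (v \<bullet> v)" by (simp add: dot_square_norm power2_eq_square)
    also have "\<dots> < T * (v \<bullet> v)" using \<open>v \<noteq> 0\<close> by (simp add: T_def)
    finally show "v \<bullet> (mat 1 *v (E T *v v)) < 0" by (simp add: E inner_diff_right)
  qed
  moreover have T0: "T \<ge> 0" unfolding T_def by (intro add_nonneg_nonneg onorm_pos_le) auto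
  ultimately have TS: "T \<in> S" by (auto simp: S_def)
  \<comment> \<open>Normalising \<open>(K, r)\<close> makes the set of Lyapunov forms of the shifts compact; \<open>r = 0\<close> is
    impossible because it would give an eigenvalue of \<open>D\<close> with real part \<open>t \<ge> 0\<close>.\<close>
  define Z where "Z = {(t, K, r) | t K r :: real. 0 \<le> t \<and> t \<le> T \<and> transpose K = K \<and>
    (\<forall>v. v \<bullet> (K *v v) \<ge> 0) \<and> r \<ge> 0 \<and>
    (\<forall>v. 2 * (v \<bullet> (K *v (D *v v)) - t * (v \<bullet> (K *v v))) + r * (v \<bullet> v) = 0) \<and> norm (K, r) = 1}"
  have Z_Collect: "Z = {x. 0 \<le> fst x \<and> fst x \<le> T \<and> transpose (fst (snd x)) = fst (snd x) \<and>
    (\<forall>v. 0 \<le> v \<bullet> (fst (snd x) *v v)) \<and> 0 \<le> snd (snd x) \<and>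
    (\<forall>v. 2 * (v \<bullet> (fst (snd x) *v (D *v v)) - fst x * (v \<bullet> (fst (snd x) *v v)))
       + snd (snd x) * (v \<bullet> v) = 0) \<and> norm (snd x) = 1}"
    by (auto simp: Z_def)
  have "closed Z" unfolding Z_Collect
    by (intro closed_Collect_conj closed_Collect_all closed_Collect_le closed_Collect_eq continuous_intros
        linear_continuous_on_compose[OF _ linear_transpose]
        linear_continuous_on_compose[OF _ linear_matrix_apply])
  moreover have "Z \<subseteq> {0..T} \<times> sphere 0 1" by (auto simp: Z_def)
  then have "bounded Z" by (rule bounded_subset[rotated]) (intro bounded_Times, auto)
  ultimately have "compact Z" by (simp add: compact_eq_bounded_closed)
  then have "compact (fst ` Z)" by (intro compact_continuous_image continuous_intros)
  have Z_S: "t \<in> S" if tZ: "(t, K, r) \<in> Z" for t K r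
  proof -
    have t: "0 \<le> t" and K: "sym_pos_semidef K" and r: "0 \<le> r" and n: "norm (K, r) = 1"
      and eq: "\<And>v. 2 * (v \<bullet> (K *v (D *v v)) - t * (v \<bullet> (K *v v))) + r * (v \<bullet> v) = 0"
      using tZ by (auto simp: Z_def sym_pos_semidef_def)
    have q: "2 * (v \<bullet> (K *v (E t *v v))) = - r * (v \<bullet> v)" for v
      using eq[of v]
      by (simp add: E matrix_vector_mult_diff_distrib matrix_vector_mult_scaleR inner_diff_right)
    have "r \<noteq> 0"
    proof
      assume r0: "r = 0"
      then have "K \<noteq> 0" using n by auto
      moreover have "v \<bullet> (K *v (E t *v v)) = 0" for v using q[of v] r0 by simp
      ultimately obtain z where "complex_eigenvalue (E t) z" "Re z = 0"
        using psd_skew_imp_imaginary_eigenvalue[OF K] by metis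
      then have "complex_eigenvalue D (z + of_real t)" "Re (z + of_real t) = t"
        using complex_eigenvalue_shift[of D t z] by (auto simp: E_def)
      then show False using assms t unfolding lambda_bar_less_iff by force
    qed
    then have r: "r > 0" using r by simp
    have neg: "v \<bullet> (K *v (E t *v v)) < 0" if "v \<noteq> 0" for v
    proof -
      have "r * (v \<bullet> v) > 0" using r that by simp
      then show ?thesis using q[of v] by linarith
    qed
    \<comment> \<open>At a kernel vector the decay would be zero, contradicting
      \<open>neg\<close>.\<close>
    have "v = 0" if "K *v v = 0" for v
      using neg[of v] K that inner_symmetric_matrix[of K v "E t *v v"]
      by (auto simp: sym_pos_semidef_def)
    then have "lyapunov K (E t)" using K neg by (auto simp: lyapunov_def sym_pos_def_iff_kernel)
    then show ?thesis using t by (auto simp: S_def)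
  qed
  have S_Z: "t \<in> fst ` Z" if tS: "t \<in> S" "t \<le> T" for t
  proof -
    obtain K0 where K0: "lyapunov K0 (E t)" using tS by (auto simp: S_def)
    \<comment> \<open>An arbitrary Lyapunov form is replaced by the one decaying at the rate
      prescribed by the identity, which after scaling lies in \<open>Z\<close>.\<close>
    have "transpose (- mat 1 :: real^'n^'n) = - mat 1" by (simp add: transpose_uminus)
    from lyapunov_equation[OF K0 this] obtain K
      where K: "transpose K = K" and q: "\<And>v. 2 * (v \<bullet> (K *v (E t *v v))) = v \<bullet> ((- mat 1) *v v)"
      by metis
    have q': "2 * (v \<bullet> (K *v (E t *v v))) = - (v \<bullet> v)" for v
      using q[of v] by (simp add: matrix_vector_mult_minus_left)
    have psd: "sym_pos_semidef K"
    proof (rule lyapunov_comparison[OF K0 K])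
      show "v \<bullet> (K *v (E t *v v)) \<le> 0" for v using q'[of v] inner_ge_zero[of v] by linarith
    qed
    define r where "r = norm (K, 1 :: real)"
    have r: "r > 0" by (simp add: r_def zero_prod_def)
    define s where "s = inverse r"
    have s: "s > 0" using r by (simp add: s_def)
    have sK: "(s *\<^sub>R K) *v v = s *\<^sub>R (K *v v)" for v by (simp add: scaleR_matrix_vector_assoc)
    have "2 * (v \<bullet> ((s *\<^sub>R K) *v (D *v v)) - t * (v \<bullet> ((s *\<^sub>R K) *v v))) + s * (v \<bullet> v)
        = s * (2 * (v \<bullet> (K *v (E t *v v))) + v \<bullet> v)" for v
      by (simp add: sK E matrix_vector_mult_diff_distrib matrix_vector_mult_scaleR
          inner_diff_right algebra_simps)
    then have "2 * (v \<bullet> ((s *\<^sub>R K) *v (D *v v)) - t * (v \<bullet> ((s *\<^sub>R K) *v v))) + s * (v \<bullet> v) = 0" for v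
      by (simp add: q')
    moreover have "norm (s *\<^sub>R K, s) = 1"
    proof -
      have "norm (s *\<^sub>R (K, 1 :: real)) = s * r" using s by (simp only: norm_scaleR r_def abs_of_pos)
      then have "norm (s *\<^sub>R K, s) = s * r" by simp
      then show ?thesis using r by (simp add: s_def)
    qed
    ultimately have "(t, s *\<^sub>R K, s) \<in> Z"
      using tS psd s unfolding Z_def
      by (auto simp: S_def sym_pos_semidef_def sK transpose_scalar)
    then show ?thesis by force
  qed
  have "fst ` Z \<noteq> {}" using S_Z[OF TS] by auto
  from compact_attains_inf[OF \<open>compact (fst ` Z)\<close> this]
  obtain t where t: "t \<in> fst ` Z" and least: "\<And>s. s \<in> fst ` Z \<Longrightarrow> t \<le> s" by auto
  have tS: "t \<in> S" "t \<le> T" using t Z_S by (auto simp: Z_def)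
  obtain K where K: "lyapunov K (E t)" using tS by (auto simp: S_def)
  obtain e where e: "e > 0" "\<And>D'. (\<And>v. norm (D' *v v - E t *v v) \<le> e * norm v) \<Longrightarrow> lyapunov K D'"
    using lyapunov_perturb[OF K] by metis
  \<comment> \<open>A step down of length at most \<open>e\<close>, truncated to stay nonnegative;
    minimality of \<open>t\<close> then forces \<open>t = 0\<close>.\<close>
  define s where "s = max 0 (t - e)"
  have "lyapunov K (E s)"
  proof (rule e(2))
    fix v
    have "E s *v v - E t *v v = (t - s) *\<^sub>R v" by (simp add: E algebra_simps)
    moreover have "\<bar>t - s\<bar> \<le> e" using e(1) tS by (auto simp: s_def S_def)
    ultimately show "norm (E s *v v - E t *v v) \<le> e * norm v" by (simp add: mult_right_mono)
  qed
  then have "s \<in> S" by (auto simp: S_def s_def)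
  moreover have "s \<le> t" using e(1) tS by (auto simp: s_def S_def)
  ultimately have "t \<le> s" using least S_Z tS(2) by auto
  then have "t = 0" using e(1) tS by (auto simp: s_def S_def split: if_splits)
  then show ?thesis using K by (auto simp: E_def)
qed

section \<open>The algebraic Riccati equation\<close>

lemma sym_pos_def_matrix_inv:
  fixes R :: "real^'n^'n"
  assumes "sym_pos_def R"
  shows "R ** matrix_inv R = mat 1" "transpose (matrix_inv R) = matrix_inv R"
proof -
  have "invertible R"
    unfolding invertible_left_inverse matrix_left_invertible_ker
    using assms sym_pos_def_iff_kernel by blast
  then have inv: "R ** matrix_inv R = mat 1 \<and> matrix_inv R ** R = mat 1"
    unfolding invertible_def matrix_inv_def by (rule someI_ex)
  then show "R ** matrix_inv R = mat 1" ..
  have "transpose (R ** matrix_inv R) = mat 1" using inv by simp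
  then have "transpose (matrix_inv R) ** R = mat 1"
    using assms by (simp add: matrix_transpose_mul sym_pos_def_def)
  then have "matrix_inv R = (transpose (matrix_inv R) ** R) ** matrix_inv R" by simp
  then show "transpose (matrix_inv R) = matrix_inv R"
    using inv by (simp add: matrix_mul_assoc[symmetric])
qed

text \<open>The feedback formula at an arbitrary \<open>K\<close>, so that it also applies to
  solutions of the Riccati inequality.\<close>

definition riccati_gain :: "real^'q^'q \<Rightarrow> real^'q^'p \<Rightarrow> real^'p^'p \<Rightarrow> real^'p^'q" where
  "riccati_gain R B K = - (matrix_inv R ** transpose B ** K)"

lemma riccati_gain_apply:
  "riccati_gain R B K *v v = - ((matrix_inv R ** transpose B) *v (K *v v))"
  by (simp add: riccati_gain_def matrix_vector_mult_minus_left matrix_vector_mul_assoc)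

lemma weighted_riccati_gain:
  fixes B :: "real^'q^'p"
  assumes "sym_pos_def R"
  shows "R *v (riccati_gain R B K *v v) = - (transpose B *v (K *v v))"
proof -
  have "R *v (riccati_gain R B K *v v) = - ((R ** (matrix_inv R ** transpose B)) *v (K *v v))"
    using matrix_vector_mult_diff_distrib[of R 0]
    by (simp add: riccati_gain_apply matrix_vector_mul_assoc matrix_mul_assoc)
  then show ?thesis
    by (simp add: matrix_mul_assoc sym_pos_def_matrix_inv(1)[OF assms] del: transpose_matrix_vector)
qed

lemma quadratic_form_riccati_map:
  fixes Q A K :: "real^'p^'p" and B :: "real^'q^'p"
  assumes R: "sym_pos_def R" and K: "transpose K = K"
  shows "v \<bullet> (riccati_map Q R A B K *v v) = 2 * (v \<bullet> (K *v (A *v v)))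
    - (riccati_gain R B K *v v) \<bullet> (R *v (riccati_gain R B K *v v)) + v \<bullet> (Q *v v)"
proof -
  define g where "g = riccati_gain R B K *v v"
  have "(K ** B ** matrix_inv R ** transpose B ** K) *v v = - (K *v (B *v g))"
    using matrix_vector_mult_diff_distrib[of B 0] matrix_vector_mult_diff_distrib[of K 0]
    by (simp add: g_def riccati_gain_apply matrix_vector_mul_assoc matrix_mul_assoc)
  then have "v \<bullet> ((K ** B ** matrix_inv R ** transpose B ** K) *v v) = - ((K *v v) \<bullet> (B *v g))"
    using inner_symmetric_matrix[OF K, of v "B *v g"] by simp
  also have "\<dots> = - ((transpose B *v (K *v v)) \<bullet> g)"
    using inner_matrix_vector_transpose[of "K *v v" B g] by simp
  also have "\<dots> = g \<bullet> (R *v g)"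
    unfolding g_def weighted_riccati_gain[OF R] by (simp add: inner_commute)
  finally show ?thesis
    using quadratic_form_lyapunov_operator[OF K, of v A]
    unfolding riccati_map_def g_def[symmetric] matrix_vector_mult_add_rdistrib
      matrix_vector_mult_diff_rdistrib inner_add_right inner_diff_right
    by simp
qed

lemma transpose_riccati_map:
  fixes Q A K :: "real^'p^'p" and B :: "real^'q^'p"
  assumes "transpose Q = Q" "sym_pos_def R" "transpose K = K"
  shows "transpose (riccati_map Q R A B K) = riccati_map Q R A B K"
proof -
  have diff: "transpose (X - Y) = transpose X - transpose Y" for X Y :: "real^'p^'p"
    by (simp add: transpose_def vec_eq_iff)
  show ?thesis
    using transpose_lyapunov_operator[OF assms(3), of A]
    unfolding riccati_map_def transpose_add diff matrix_transpose_mul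
      sym_pos_def_matrix_inv(2)[OF assms(2)] assms(1,3) transpose_transpose
    by (simp add: matrix_mul_assoc add.commute)
qed

text \<open>Along the loop closed with any gain \<open>L\<close>, the decay of \<open>K\<close> is
  its Riccati residual, minus the running cost of \<open>L\<close>, plus a penalty for deviating
  from the gain of \<open>K\<close>. All later comparisons are instances.\<close>

lemma riccati_completion_of_squares:
  fixes Q A K :: "real^'p^'p" and B :: "real^'q^'p" and L :: "real^'p^'q"
  assumes R: "sym_pos_def R" and K: "transpose K = K"
  shows "2 * (v \<bullet> (K *v ((A + B ** L) *v v))) = v \<bullet> (riccati_map Q R A B K *v v)
    - v \<bullet> (Q *v v) - (L *v v) \<bullet> (R *v (L *v v))
    + (L *v v - riccati_gain R B K *v v) \<bullet> (R *v (L *v v - riccati_gain R B K *v v))"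
proof -
  define g where "g = riccati_gain R B K *v v"
  have symR: "transpose R = R" using R by (simp add: sym_pos_def_def)
  have "v \<bullet> (K *v (B *v (L *v v))) = (transpose B *v (K *v v)) \<bullet> (L *v v)"
    using inner_symmetric_matrix[OF K, of v] inner_matrix_vector_transpose[of "K *v v" B] by simp
  also have "\<dots> = - ((L *v v) \<bullet> (R *v g))"
    unfolding g_def weighted_riccati_gain[OF R] by (simp add: inner_commute)
  finally have "v \<bullet> (K *v ((A + B ** L) *v v)) = v \<bullet> (K *v (A *v v)) - (L *v v) \<bullet> (R *v g)"
    by (simp add: matrix_vector_mult_add_rdistrib matrix_vector_right_distrib inner_add_right
        matrix_vector_mul_assoc[symmetric])
  moreover have "(L *v v - g) \<bullet> (R *v (L *v v - g))
      = (L *v v) \<bullet> (R *v (L *v v)) - 2 * ((L *v v) \<bullet> (R *v g)) + g \<bullet> (R *v g)"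
    using inner_symmetric_matrix[OF symR, of g "L *v v"]
    by (simp add: matrix_vector_mult_diff_distrib inner_diff_left inner_diff_right inner_commute)
  ultimately show ?thesis
    using quadratic_form_riccati_map[OF R K, of v Q A B] unfolding g_def[symmetric] by simp
qed

lemma sym_pos_def_nonneg: "sym_pos_def R \<Longrightarrow> x \<bullet> (R *v x) \<ge> 0"
  using sym_pos_def_semidef sym_pos_semidef_def by blast

text \<open>With the gain of \<open>K\<close> itself the penalty vanishes and the running cost makes
  the decay strict. At a kernel vector of \<open>K\<close> the Riccati form reduces to that of
  \<open>Q\<close>, so the kernel is trivial.\<close>

lemma riccati_inequality_lyapunov:
  fixes Q A K :: "real^'p^'p" and B :: "real^'q^'p"
  assumes Q: "sym_pos_def Q" and R: "sym_pos_def R" and K: "sym_pos_semidef K"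
    and le: "\<And>v. v \<bullet> (riccati_map Q R A B K *v v) \<le> 0"
  shows "lyapunov K (A + B ** riccati_gain R B K)"
proof -
  have sym: "transpose K = K" using K by (simp add: sym_pos_semidef_def)
  have posQ: "\<And>v. v \<noteq> 0 \<Longrightarrow> v \<bullet> (Q *v v) > 0" using Q by (simp add: sym_pos_def_def)
  have "v = 0" if v: "K *v v = 0" for v
  proof (rule ccontr)
    assume "v \<noteq> 0"
    moreover have "v \<bullet> (K *v (A *v v)) = 0"
      using inner_symmetric_matrix[OF sym, of v "A *v v"] v by simp
    moreover have "riccati_gain R B K *v v = 0" by (simp add: riccati_gain_apply v)
    ultimately show False
      using le[of v] posQ[of v] quadratic_form_riccati_map[OF R sym, of v Q A B] by simp
  qed
  moreover have "v \<bullet> (K *v ((A + B ** riccati_gain R B K) *v v)) < 0" if "v \<noteq> 0" for v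
    using riccati_completion_of_squares[OF R sym, of v A B "riccati_gain R B K" Q] le[of v]
      posQ[OF that] sym_pos_def_nonneg[OF R, of "riccati_gain R B K *v v"] by simp
  ultimately show ?thesis using K by (auto simp: lyapunov_def sym_pos_def_iff_kernel)
qed

text \<open>\<open>X\<close> is the cost form of the gain \<open>L\<close>, obtained from a Lyapunov
  equation. Its Riccati residual is minus the penalty for \<open>L\<close> deviating from the gain
  of \<open>X\<close>, hence nonpositive.\<close>

lemma kleinman_step:
  fixes Q A K0 :: "real^'p^'p" and B :: "real^'q^'p" and L :: "real^'p^'q"
  assumes Q: "sym_pos_def Q" and R: "sym_pos_def R" and K0: "lyapunov K0 (A + B ** L)"
  obtains X where "sym_pos_semidef X"
    "\<And>v. 2 * (v \<bullet> (X *v ((A + B ** L) *v v))) = - (v \<bullet> (Q *v v)) - (L *v v) \<bullet> (R *v (L *v v))"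
    "\<And>v. v \<bullet> (riccati_map Q R A B X *v v) \<le> 0"
proof -
  define P where "P = - (Q + transpose L ** R ** L)"
  have "transpose P = P"
    using Q R by (simp add: P_def transpose_uminus transpose_add matrix_transpose_mul sym_pos_def_def
        matrix_mul_assoc del: minus_add_distrib)
  from lyapunov_equation[OF K0 this] obtain X where X: "transpose X = X"
    and qP: "\<And>v. 2 * (v \<bullet> (X *v ((A + B ** L) *v v))) = v \<bullet> (P *v v)" by metis
  have "v \<bullet> (P *v v) = - (v \<bullet> (Q *v v)) - (L *v v) \<bullet> (R *v (L *v v))" for v
    using inner_matrix_vector_transpose[of v "transpose L" "R *v (L *v v)"]
    unfolding P_def matrix_vector_mult_minus_left matrix_vector_mult_add_rdistrib
      matrix_vector_mul_assoc[symmetric] by (simp add: inner_add_right inner_diff_right)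
  with qP have q: "2 * (v \<bullet> (X *v ((A + B ** L) *v v)))
      = - (v \<bullet> (Q *v v)) - (L *v v) \<bullet> (R *v (L *v v))" for v by simp
  have "sym_pos_semidef X"
  proof (rule lyapunov_comparison[OF K0 X])
    show "v \<bullet> (X *v ((A + B ** L) *v v)) \<le> 0" for v
      using q[of v] sym_pos_def_nonneg[OF Q, of v] sym_pos_def_nonneg[OF R, of "L *v v"] by linarith
  qed
  moreover have "v \<bullet> (riccati_map Q R A B X *v v) \<le> 0" for v
    using q[of v] riccati_completion_of_squares[OF R X, of v A B L Q]
      sym_pos_def_nonneg[OF R, of "L *v v - riccati_gain R B X *v v"] by linarith
  ultimately show thesis using q by (intro that)
qed

lemma riccati_solution_exists:
  fixes Q A K0 :: "real^'p^'p" and B :: "real^'q^'p" and L :: "real^'p^'q"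
  assumes Q: "sym_pos_def Q" and R: "sym_pos_def R" and K0: "lyapunov K0 (A + B ** L)"
  shows "\<exists>K. sym_pos_semidef K \<and> riccati_map Q R A B K = 0"
proof -
  have symQ: "transpose Q = Q" using Q by (simp add: sym_pos_def_def)
  define S where "S = {K. sym_pos_semidef K \<and> (\<forall>v. v \<bullet> (riccati_map Q R A B K *v v) \<le> 0)}"
  obtain X0 where "sym_pos_semidef X0" "\<And>v. v \<bullet> (riccati_map Q R A B X0 *v v) \<le> 0"
    using kleinman_step[OF Q R K0] by metis
  then have X0: "X0 \<in> S" by (simp add: S_def)
  \<comment> \<open>Cutting at the trace of one known member gives a compact set on which the least
    trace is attained.\<close>
  define C where "C = {K \<in> S. trace K \<le> trace X0}"
  have C_Collect: "C = {K. transpose K = K \<and> (\<forall>v. 0 \<le> v \<bullet> (K *v v)) \<and>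
    (\<forall>v. 2 * (v \<bullet> (K *v (A *v v))) - ((matrix_inv R ** transpose B) *v (K *v v)) \<bullet>
      (R *v ((matrix_inv R ** transpose B) *v (K *v v))) + v \<bullet> (Q *v v) \<le> 0) \<and> trace K \<le> trace X0}"
  proof -
    have "R *v (- x) = - (R *v x)" for x using matrix_vector_mult_diff_distrib[of R 0 x] by simp
    then show ?thesis
      unfolding C_def S_def sym_pos_semidef_def
      by (auto simp: quadratic_form_riccati_map[OF R] riccati_gain_apply)
  qed
  have "closed C" unfolding C_Collect trace_def
    by (intro closed_Collect_conj closed_Collect_all closed_Collect_le closed_Collect_eq continuous_intros
        linear_continuous_on_compose[OF _ linear_transpose]
        linear_continuous_on_compose[OF _ matrix_vector_mul_linear]
        linear_continuous_on_compose[OF _ linear_matrix_apply])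
  moreover have "bounded C" unfolding bounded_iff
  proof (intro exI ballI)
    fix K assume K: "K \<in> C"
    have "norm K \<le> real CARD('p) * (real CARD('p) * trace K)"
      by (rule norm_le_trace) (use K in \<open>simp add: C_def S_def\<close>)
    also have "\<dots> \<le> real CARD('p) * (real CARD('p) * trace X0)"
      by (intro mult_left_mono) (use K in \<open>auto simp: C_def\<close>)
    finally show "norm K \<le> real CARD('p) * (real CARD('p) * trace X0)" .
  qed
  ultimately have "compact C" by (simp add: compact_eq_bounded_closed)
  moreover have "C \<noteq> {}" using X0 by (auto simp: C_def)
  moreover have "continuous_on C trace" unfolding trace_def by (intro continuous_intros)
  ultimately obtain K where KC: "K \<in> C" and least: "\<And>Y. Y \<in> C \<Longrightarrow> trace K \<le> trace Y"
    using continuous_attains_inf[of C trace] by blast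
  have K: "sym_pos_semidef K" and le: "\<And>v. v \<bullet> (riccati_map Q R A B K *v v) \<le> 0"
    using KC by (auto simp: C_def S_def)
  have sym: "transpose K = K" using K by (simp add: sym_pos_semidef_def)
  define G where "G = riccati_gain R B K"
  have lyap: "lyapunov K (A + B ** G)"
    unfolding G_def by (rule riccati_inequality_lyapunov[OF Q R K le])
  obtain X where X: "sym_pos_semidef X"
    and q: "\<And>v. 2 * (v \<bullet> (X *v ((A + B ** G) *v v))) = - (v \<bullet> (Q *v v)) - (G *v v) \<bullet> (R *v (G *v v))"
    and leX: "\<And>v. v \<bullet> (riccati_map Q R A B X *v v) \<le> 0"
    using kleinman_step[OF Q R lyap] by metis
  have qK: "2 * (v \<bullet> (K *v ((A + B ** G) *v v)))
      = v \<bullet> (riccati_map Q R A B K *v v) - v \<bullet> (Q *v v) - (G *v v) \<bullet> (R *v (G *v v))" for v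
    using riccati_completion_of_squares[OF R sym, of v A B G Q] by (simp add: G_def)
  \<comment> \<open>The running costs cancel: twice the decay of \<open>K - X\<close> is the Riccati
    residual of \<open>K\<close>, which is nonpositive.\<close>
  have E: "sym_pos_semidef (K - X)"
  proof (rule lyapunov_comparison[OF lyap])
    show "transpose (K - X) = K - X"
      using sym X by (simp add: sym_pos_semidef_def transpose_def vec_eq_iff)
    show "v \<bullet> ((K - X) *v ((A + B ** G) *v v)) \<le> 0" for v
      using q[of v] qK[of v] le[of v]
      by (simp add: matrix_vector_mult_diff_rdistrib inner_diff_right)
  qed
  have "trace X \<le> trace K" using trace_nonneg[OF E] by (simp add: trace_sub)
  then have "X \<in> C" using X leX KC by (auto simp: C_def S_def)
  then have "trace (K - X) \<le> 0" using least[of X] by (simp add: trace_sub)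
  then have "\<bar>(K - X) $ i $ j\<bar> \<le> 0" for i j using abs_entry_le_trace[OF E, of i j] by linarith
  then have "K = X" by (simp add: vec_eq_iff)
  \<comment> \<open>With \<open>K = X\<close> the identities \<open>q\<close> and \<open>qK\<close>
    differ only by the residual of \<open>K\<close>.\<close>
  then have "riccati_map Q R A B K = 0"
    using q qK by (intro symmetric_eq_zeroI transpose_riccati_map[OF symQ R sym]) force
  then show ?thesis using K by blast
qed

text \<open>Along the loop closed with the gain of \<open>K\<close>, the form \<open>K\<close>
  decays by the full running cost and \<open>K'\<close> by that cost less a penalty, so
  \<open>K - K'\<close> does not increase. Exchanging the roles yields uniqueness.\<close>

lemma riccati_comparison:
  fixes Q A K K' :: "real^'p^'p" and B :: "real^'q^'p"
  assumes Q: "sym_pos_def Q" and R: "sym_pos_def R"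
    and K: "sym_pos_semidef K" "riccati_map Q R A B K = 0"
    and K': "sym_pos_semidef K'" "riccati_map Q R A B K' = 0"
  shows "v \<bullet> (K' *v v) \<le> v \<bullet> (K *v v)"
proof -
  have sym: "transpose K = K" "transpose K' = K'" using K K' by (auto simp: sym_pos_semidef_def)
  define G where "G = riccati_gain R B K"
  have lyap: "lyapunov K (A + B ** G)"
    unfolding G_def by (rule riccati_inequality_lyapunov[OF Q R K(1)]) (simp add: K(2))
  have "sym_pos_semidef (K - K')"
  proof (rule lyapunov_comparison[OF lyap])
    show "transpose (K - K') = K - K'"
      using sym by (simp add: transpose_def vec_eq_iff)
    show "v \<bullet> ((K - K') *v ((A + B ** G) *v v)) \<le> 0" for v
      using riccati_completion_of_squares[OF R sym(1), of v A B G Q]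
        riccati_completion_of_squares[OF R sym(2), of v A B G Q]
        sym_pos_def_nonneg[OF R, of "G *v v - riccati_gain R B K' *v v"]
      by (simp add: K(2) K'(2) G_def[symmetric] matrix_vector_mult_diff_rdistrib inner_diff_right)
  qed
  then show ?thesis
    by (simp add: sym_pos_semidef_def matrix_vector_mult_diff_rdistrib inner_diff_right)
qed

lemma feedback_well_defined_if_lyapunov:
  fixes Q A K0 :: "real^'p^'p" and B :: "real^'q^'p" and L :: "real^'p^'q"
  assumes Q: "sym_pos_def Q" and R: "sym_pos_def R" and "lyapunov K0 (A + B ** L)"
  shows "feedback_well_defined Q R A B"
  unfolding feedback_well_defined_def
proof (rule ex_ex1I)
  show "\<exists>K. sym_pos_semidef K \<and> riccati_map Q R A B K = 0"
    by (rule riccati_solution_exists[OF assms])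
next
  fix K K' assume K: "sym_pos_semidef K \<and> riccati_map Q R A B K = 0"
    "sym_pos_semidef K' \<and> riccati_map Q R A B K' = 0"
  have "K - K' = 0"
  proof (rule symmetric_eq_zeroI)
    show "transpose (K - K') = K - K'"
      using K by (simp add: sym_pos_semidef_def transpose_def vec_eq_iff)
    show "v \<bullet> ((K - K') *v v) = 0" for v
      using riccati_comparison[OF Q R, of K A B K' v] riccati_comparison[OF Q R, of K' A B K v] K
      by (simp add: matrix_vector_mult_diff_rdistrib inner_diff_right)
  qed
  then show "K = K'" by simp
qed

lemma riccati_sol_solves:
  assumes "feedback_well_defined Q R A B"
  shows "sym_pos_semidef (riccati_sol Q R A B)" "riccati_map Q R A B (riccati_sol Q R A B) = 0"
  using theI'[OF assms[unfolded feedback_well_defined_def]] by (simp_all add: riccati_sol_def)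

lemma feedback_eq_riccati_gain: "feedback Q R A B = riccati_gain R B (riccati_sol Q R A B)"
  by (simp add: feedback_def riccati_gain_def)

section \<open>Perturbation of the feedback\<close>

lemma norm_le_op_norm: "norm (M *v x) \<le> op_norm M * norm x"
  unfolding op_norm_def by (rule onorm) simp

lemma op_norm_nonneg: "op_norm M \<ge> 0"
  unfolding op_norm_def by (rule onorm_pos_le) simp

lemma op_norm_pos: "op_norm M > 0" if "M \<noteq> 0"
  unfolding op_norm_def using that by (subst onorm_pos_lt) (auto simp: matrix_eq)

lemma op_norm_le_trace:
  fixes K :: "real^'n^'n"
  assumes "sym_pos_semidef K"
  shows "op_norm K \<le> real CARD('n) * real CARD('n) * trace K"
  unfolding op_norm_def by (rule onorm_le_matrix_component) (rule abs_entry_le_trace[OF assms])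

lemma inner_perturbation_le:
  fixes K :: "real^'n^'n"
  assumes "op_norm K \<le> C" "norm e \<le> d"
  shows "\<bar>v \<bullet> (K *v e)\<bar> \<le> norm v * (C * d)"
proof -
  have "C \<ge> 0" using assms(1) op_norm_nonneg[of K] by linarith
  have "norm (K *v e) \<le> op_norm K * norm e" by (rule norm_le_op_norm)
  also have "\<dots> \<le> C * d" by (rule mult_mono) (use assms \<open>C \<ge> 0\<close> in auto)
  finally have "norm (K *v e) \<le> C * d" .
  then show ?thesis
    by (intro order_trans[OF Cauchy_Schwarz_ineq2] mult_left_mono) auto
qed

locale riccati_nominal =
  fixes Q Astar Kstar :: "real^'p^'p" and R :: "real^'q^'q" and Bstar :: "real^'q^'p"
    and Lstar :: "real^'p^'q"
  assumes Q: "sym_pos_def Q" and R: "sym_pos_def R"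
    and Kstar: "sym_pos_semidef Kstar" "riccati_map Q R Astar Bstar Kstar = 0"
    and Lstar: "Lstar = riccati_gain R Bstar Kstar"
begin

lemma sym_Kstar: "transpose Kstar = Kstar"
  using Kstar by (simp add: sym_pos_semidef_def)

lemma pos_def_Kstar: "sym_pos_def Kstar"
  using riccati_inequality_lyapunov[OF Q R Kstar(1), of Astar Bstar] Kstar(2)
  by (simp add: lyapunov_def)

lemma nominal_form:
  "2 * (v \<bullet> (Kstar *v ((Astar + Bstar ** L) *v v)))
    = - (v \<bullet> (Q *v v)) - (L *v v) \<bullet> (R *v (L *v v))
      + (L *v v - Lstar *v v) \<bullet> (R *v (L *v v - Lstar *v v))"
  using riccati_completion_of_squares[OF R sym_Kstar, of v Astar Bstar L Q] Kstar(2) Lstar by simp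

text \<open>When the nominal gain is zero, the control cost of \<open>L\<close> equals its penalty,
  and only the cost from \<open>Q\<close> remains.\<close>

lemma zero_gain_lyapunov:
  assumes "Lstar = 0"
  shows "lyapunov Kstar (Astar + Bstar ** L)"
  unfolding lyapunov_def
proof (intro conjI allI impI)
  fix v :: "real^'p" assume "v \<noteq> 0"
  then have "v \<bullet> (Q *v v) > 0" using Q by (simp add: sym_pos_def_def)
  then show "v \<bullet> (Kstar *v ((Astar + Bstar ** L) *v v)) < 0"
    using nominal_form[of v L] assms by simp
qed (rule pos_def_Kstar)

section \<open>Quantitative estimates in terms of coercivity constants of \<open>Q\<close> and
  \<open>R\<close>\<close>

context
  fixes a b :: real
  assumes a: "a > 0" "\<And>v. a * (norm v)\<^sup>2 \<le> v \<bullet> (Q *v v)"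
    and b: "b > 0" "\<And>w. b * (norm w)\<^sup>2 \<le> w \<bullet> (R *v w)"
begin

text \<open>The perturbation consumes at most half of the \<open>Q\<close> cost. That of
  \<open>B\<close> is measured only through \<open>Lstar\<close>, so it costs nothing when
  \<open>Lstar = 0\<close>.\<close>

lemma perturbed_nominal_form:
  fixes A :: "real^'p^'p" and B :: "real^'q^'p"
  assumes e: "8 * op_norm Kstar * e \<le> a"
    and A: "\<And>v. norm ((A - Astar) *v v) \<le> e * norm v"
    and B: "\<And>v. norm ((B - Bstar) *v (Lstar *v v)) \<le> e * norm v"
  shows "2 * (v \<bullet> (Kstar *v ((A + B ** Lstar) *v v)))
    \<le> - (v \<bullet> (Q *v v) + (Lstar *v v) \<bullet> (R *v (Lstar *v v))) / 2"
proof -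
  define u where "u = (A - Astar) *v v + (B - Bstar) *v (Lstar *v v)"
  have "norm u \<le> 2 * e * norm v"
    unfolding u_def using norm_triangle_mono[OF A B, of v v] by simp
  from abs_le_D1[OF inner_perturbation_le[OF order_refl this, of v Kstar]]
  have "2 * (v \<bullet> (Kstar *v u)) \<le> 4 * (op_norm Kstar * e) * (norm v)\<^sup>2"
    by (simp add: power2_eq_square mult_ac)
  also have "\<dots> \<le> a / 2 * (norm v)\<^sup>2" by (rule mult_right_mono) (use e in auto)
  also have "\<dots> \<le> v \<bullet> (Q *v v) / 2" using a(2)[of v] by simp
  finally have "2 * (v \<bullet> (Kstar *v u)) \<le> v \<bullet> (Q *v v) / 2" .
  moreover have "(A + B ** Lstar) *v v = (Astar + Bstar ** Lstar) *v v + u"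
    by (simp add: u_def matrix_vector_mult_add_rdistrib matrix_vector_mult_diff_rdistrib
        matrix_vector_mul_assoc[symmetric])
  then have "v \<bullet> (Kstar *v ((A + B ** Lstar) *v v))
      = v \<bullet> (Kstar *v ((Astar + Bstar ** Lstar) *v v)) + v \<bullet> (Kstar *v u)"
    by (simp add: matrix_vector_right_distrib inner_add_right)
  ultimately show ?thesis
    using nominal_form[of v Lstar] sym_pos_def_nonneg[OF R, of "Lstar *v v"] by simp
qed

lemma perturbed_lyapunov:
  fixes A :: "real^'p^'p" and B :: "real^'q^'p"
  assumes e: "8 * op_norm Kstar * e \<le> a"
    and A: "\<And>v. norm ((A - Astar) *v v) \<le> e * norm v"
    and B: "\<And>v. norm ((B - Bstar) *v (Lstar *v v)) \<le> e * norm v"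
  shows "lyapunov Kstar (A + B ** Lstar)"
  unfolding lyapunov_def
proof (intro conjI allI impI)
  fix v :: "real^'p" assume "v \<noteq> 0"
  then have "v \<bullet> (Q *v v) > 0" using Q by (simp add: sym_pos_def_def)
  then show "v \<bullet> (Kstar *v ((A + B ** Lstar) *v v)) < 0"
    using perturbed_nominal_form[OF assms, of v] sym_pos_def_nonneg[OF R, of "Lstar *v v"] by simp
qed (rule pos_def_Kstar)

text \<open>Along the perturbed loop with gain \<open>Lstar\<close>, twice \<open>Kstar\<close>
  decays at least by the running cost, whereas \<open>K\<close> decays at most by it; comparison
  gives \<open>K \<le> 2 Kstar\<close> as forms.\<close>

lemma perturbed_solution_trace_le:
  fixes A K :: "real^'p^'p" and B :: "real^'q^'p"
  assumes e: "8 * op_norm Kstar * e \<le> a"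
    and A: "\<And>v. norm ((A - Astar) *v v) \<le> e * norm v"
    and B: "\<And>v. norm ((B - Bstar) *v (Lstar *v v)) \<le> e * norm v"
    and K: "sym_pos_semidef K" "riccati_map Q R A B K = 0"
  shows "trace K \<le> 2 * trace Kstar"
proof -
  have sym: "transpose K = K" using K by (simp add: sym_pos_semidef_def)
  have app: "(2 *\<^sub>R Kstar - K) *v x = 2 *\<^sub>R (Kstar *v x) - K *v x" for x
    by (simp add: matrix_vector_mult_diff_rdistrib scaleR_matrix_vector_assoc)
  have "sym_pos_semidef (2 *\<^sub>R Kstar - K)"
  proof (rule lyapunov_comparison[OF perturbed_lyapunov[OF e A B]])
    show "transpose (2 *\<^sub>R Kstar - K) = 2 *\<^sub>R Kstar - K"
      using sym sym_Kstar by (simp add: transpose_def vec_eq_iff)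
    fix v
    show "v \<bullet> ((2 *\<^sub>R Kstar - K) *v ((A + B ** Lstar) *v v)) \<le> 0"
      using perturbed_nominal_form[OF e A B, of v]
        riccati_completion_of_squares[OF R sym, of v A B Lstar Q]
        sym_pos_def_nonneg[OF R, of "Lstar *v v - riccati_gain R B K *v v"]
      by (simp add: app K(2) inner_diff_right)
  qed
  from trace_nonneg[OF this] show ?thesis
    by (simp add: trace_sub) (simp add: trace_def sum_distrib_left)
qed

text \<open>\<open>K\<close> decays by the running cost along its own loop. Returning to the true
  system adds an error bounded by the squared norms of \<open>v\<close> and \<open>L *v v\<close>,
  absorbed by the \<open>Q\<close> and \<open>R\<close> costs respectively, however large the gain
  is.\<close>

lemma perturbed_gain_lyapunov:
  fixes A K :: "real^'p^'p" and B :: "real^'q^'p"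
  assumes e0: "e \<ge> 0" and e: "8 * op_norm Kstar * e \<le> a"
    and A: "\<And>v. norm ((A - Astar) *v v) \<le> e * norm v"
    and B: "\<And>v. norm ((B - Bstar) *v (Lstar *v v)) \<le> e * norm v"
    and B': "\<And>w. norm ((B - Bstar) *v w) \<le> e * norm w"
    and K: "sym_pos_semidef K" "riccati_map Q R A B K = 0"
    and C: "C = real CARD('p) * real CARD('p) * (2 * trace Kstar)"
    and eC: "4 * C * e \<le> a" "C * e \<le> b"
  shows "lyapunov K (Astar + Bstar ** riccati_gain R B K)"
proof -
  define L where "L = riccati_gain R B K"
  have "op_norm K \<le> real CARD('p) * real CARD('p) * trace K" by (rule op_norm_le_trace[OF K(1)])
  also have "\<dots> \<le> C"
    unfolding C by (intro mult_left_mono perturbed_solution_trace_le[OF e A B K]) auto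
  finally have KC: "op_norm K \<le> C" .
  then have C0: "C \<ge> 0" using op_norm_nonneg[of K] by linarith
  have lyap: "lyapunov K (A + B ** L)"
    unfolding L_def by (rule riccati_inequality_lyapunov[OF Q R K(1)]) (simp add: K(2))
  have sym: "transpose K = K" using K by (simp add: sym_pos_semidef_def)
  have "v \<bullet> (K *v ((Astar + Bstar ** L) *v v)) < 0" if v: "v \<noteq> 0" for v
  proof -
    define x y where "x = norm v" and "y = norm (L *v v)"
    have x: "x > 0" using v by (simp add: x_def)
    define u where "u = (A - Astar) *v v + (B - Bstar) *v (L *v v)"
    have "norm u \<le> e * x + e * y"
      unfolding u_def x_def y_def by (rule norm_triangle_mono[OF A B'])
    from inner_perturbation_le[OF KC this, of v, folded x_def]
    have "- 2 * (v \<bullet> (K *v u)) \<le> 2 * (x * (C * (e * x + e * y)))" by linarith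
    also have "\<dots> = (C * e) * (2 * x\<^sup>2 + 2 * x * y)" by (simp add: power2_eq_square algebra_simps)
    also have "\<dots> \<le> (C * e) * (3 * x\<^sup>2 + y\<^sup>2)"
      using sum_squares_bound[of x y] C0 e0 by (intro mult_left_mono) auto
    also have "\<dots> = (3 * (C * e)) * x\<^sup>2 + (C * e) * y\<^sup>2" by (simp add: algebra_simps)
    \<comment> \<open>The factor \<open>3 / 4\<close> leaves room for the strict inequality that
      follows.\<close>
    also have "\<dots> \<le> (3 / 4 * a) * x\<^sup>2 + b * y\<^sup>2"
      using eC by (intro add_mono mult_right_mono) auto
    also have "\<dots> < a * x\<^sup>2 + b * y\<^sup>2" using a(1) x by simp
    also have "\<dots> \<le> v \<bullet> (Q *v v) + (L *v v) \<bullet> (R *v (L *v v))"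
      unfolding x_def y_def by (intro add_mono a b)
    finally have "- 2 * (v \<bullet> (K *v u)) < v \<bullet> (Q *v v) + (L *v v) \<bullet> (R *v (L *v v))" .
    moreover have "2 * (v \<bullet> (K *v ((A + B ** L) *v v))) = - (v \<bullet> (Q *v v)) - (L *v v) \<bullet> (R *v (L *v v))"
      using riccati_completion_of_squares[OF R sym, of v A B L Q] by (simp add: K(2) L_def)
    moreover have "(Astar + Bstar ** L) *v v = (A + B ** L) *v v - u"
      by (simp add: u_def matrix_vector_mult_add_rdistrib matrix_vector_mult_diff_rdistrib
          matrix_vector_mul_assoc[symmetric])
    then have "v \<bullet> (K *v ((Astar + Bstar ** L) *v v))
        = v \<bullet> (K *v ((A + B ** L) *v v)) - v \<bullet> (K *v u)"
      by (simp add: matrix_vector_mult_diff_distrib inner_diff_right)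
    ultimately show ?thesis by linarith
  qed
  then show ?thesis using lyap by (simp add: lyapunov_def L_def)
qed

end

lemma feedback_stable_nearby:
  "\<exists>e>0. \<forall>A B. (\<forall>v. norm ((A - Astar) *v v) \<le> e * norm v) \<longrightarrow>
    (\<forall>v. norm ((B - Bstar) *v (Lstar *v v)) \<le> e * norm v) \<longrightarrow>
    (Lstar \<noteq> 0 \<longrightarrow> (\<forall>w. norm ((B - Bstar) *v w) \<le> e * norm w)) \<longrightarrow>
    feedback_well_defined Q R A B \<and> lambda_bar (Astar + Bstar ** feedback Q R A B) < 0"
proof -
  obtain a where a: "a > 0" "\<And>v. a * (norm v)\<^sup>2 \<le> v \<bullet> (Q *v v)"
    using sym_pos_def_coercive[OF Q] by metis
  obtain b where b: "b > 0" "\<And>w. b * (norm w)\<^sup>2 \<le> w \<bullet> (R *v w)"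
    using sym_pos_def_coercive[OF R] by metis
  define N where "N = op_norm Kstar"
  define C where "C = real CARD('p) * real CARD('p) * (2 * trace Kstar)"
  have N0: "N \<ge> 0" by (simp add: N_def op_norm_nonneg)
  have C0: "C \<ge> 0" using trace_nonneg[OF Kstar(1)] by (simp add: C_def)
  \<comment> \<open>A single radius meeting all three smallness conditions; the \<open>+ 1\<close>
    keeps the denominator positive.\<close>
  define e where "e = min a b / (8 * (N + C + 1))"
  have e0: "e > 0" using a b N0 C0 by (simp add: e_def)
  have "8 * (N + C + 1) * e = min a b" using N0 C0 by (simp add: e_def)
  then have "8 * (N * e) + 8 * (C * e) + 8 * e = min a b" by (simp add: algebra_simps)
  moreover have "N * e \<ge> 0" "C * e \<ge> 0" using N0 C0 e0 by simp_all
  ultimately have e: "8 * op_norm Kstar * e \<le> a" "4 * C * e \<le> a" "C * e \<le> b"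
    using e0 by (auto simp: N_def)
  show ?thesis
  proof (intro exI[of _ e] conjI[OF e0] allI impI)
    fix A :: "real^'p^'p" and B :: "real^'q^'p"
    assume "\<forall>v. norm ((A - Astar) *v v) \<le> e * norm v"
      "\<forall>v. norm ((B - Bstar) *v (Lstar *v v)) \<le> e * norm v"
      and B': "Lstar \<noteq> 0 \<longrightarrow> (\<forall>w. norm ((B - Bstar) *v w) \<le> e * norm w)"
    then have A: "norm ((A - Astar) *v v) \<le> e * norm v"
      and B: "norm ((B - Bstar) *v (Lstar *v v)) \<le> e * norm v" for v by simp_all
    have wd: "feedback_well_defined Q R A B"
      by (rule feedback_well_defined_if_lyapunov[OF Q R perturbed_lyapunov[OF a b e(1) A B]])
    have "\<exists>K. lyapunov K (Astar + Bstar ** feedback Q R A B)"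
    proof (cases "Lstar = 0")
      case True
      then show ?thesis using zero_gain_lyapunov by blast
    next
      case False
      then have "norm ((B - Bstar) *v w) \<le> e * norm w" for w using B' by simp
      from perturbed_gain_lyapunov[OF a b less_imp_le[OF e0] e(1) A B this riccati_sol_solves[OF wd] C_def e(2,3)]
      show ?thesis unfolding feedback_eq_riccati_gain by blast
    qed
    then show "feedback_well_defined Q R A B \<and> lambda_bar (Astar + Bstar ** feedback Q R A B) < 0"
      using wd lyapunov_lambda_bar by blast
  qed
qed

end

theorem theorem2:
  fixes Q Astar Dstar :: "real^'p^'p" and R :: "real^'q^'q" and Bstar :: "real^'q^'p"
  assumes "sym_pos_def Q" and "sym_pos_def R"
    and "stabilizable Astar Bstar"
    and Dstar: "Dstar = Astar + Bstar ** feedback Q R Astar Bstar"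
    and "lambda_bar Dstar \<le> -1"
  shows "\<exists>c>0. \<forall>(A :: real^'p^'p) (B :: real^'q^'p).
    op_norm (A - Astar) \<le> - c * lambda_bar Dstar * real CARD('p) powr (-1/2) \<longrightarrow>
    (feedback Q R Astar Bstar \<noteq> 0 \<longrightarrow>
       op_norm (B - Bstar) \<le> - c * lambda_bar Dstar * real CARD('p) powr (-1/2)
                               * inverse (op_norm (feedback Q R Astar Bstar))) \<longrightarrow>
    feedback_well_defined Q R A B \<and> lambda_bar (Astar + Bstar ** feedback Q R A B) < 0"
proof -
  define L where "L = feedback Q R Astar Bstar"
  define K where "K = riccati_sol Q R Astar Bstar"
  obtain L0 K0 where "lyapunov K0 (Astar + Bstar ** L0)"
    using assms(3) lambda_bar_imp_lyapunov unfolding stabilizable_def by blast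
  then have wd: "feedback_well_defined Q R Astar Bstar"
    by (rule feedback_well_defined_if_lyapunov[OF assms(1,2)])
  interpret riccati_nominal Q Astar K R Bstar L
    by unfold_locales
      (use assms(1,2) riccati_sol_solves[OF wd] feedback_eq_riccati_gain in \<open>auto simp: K_def L_def\<close>)
  obtain e where e0: "e > 0" and e: "\<forall>A B. (\<forall>v. norm ((A - Astar) *v v) \<le> e * norm v) \<longrightarrow>
       (\<forall>v. norm ((B - Bstar) *v (L *v v)) \<le> e * norm v) \<longrightarrow>
       (L \<noteq> 0 \<longrightarrow> (\<forall>w. norm ((B - Bstar) *v w) \<le> e * norm w)) \<longrightarrow>
       feedback_well_defined Q R A B \<and> lambda_bar (Astar + Bstar ** feedback Q R A B) < 0"
    using feedback_stable_nearby by (elim exE conjE)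
  define l where "l = - lambda_bar Dstar"
  have l: "l \<ge> 1" using assms(5) by (simp add: l_def)
  \<comment> \<open>The bound on \<open>B - Bstar\<close> carries the inverse norm of
    \<open>L\<close>. The cap \<open>1\<close> controls \<open>(B - Bstar) ** L\<close>, the cap
    \<open>op_norm L\<close> controls \<open>B - Bstar\<close> itself.\<close>
  define m where "m = (if L = 0 then 1 else min 1 (op_norm L))"
  have m: "m > 0" "m \<le> 1" "L \<noteq> 0 \<Longrightarrow> m \<le> op_norm L"
    using op_norm_pos[of L] by (auto simp: m_def)
  \<comment> \<open>Division by \<open>l\<close> cancels the factor
    \<open>- lambda_bar Dstar\<close> in both bounds.\<close>
  define c where "c = e * m / l"
  have c: "c > 0" using e0 m l by (simp add: c_def)
  \<comment> \<open>The dimension factor only shrinks the admissible neighbourhood.\<close>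
  have "real CARD('p) powr (-1/2) \<le> 1"
    using powr_mono[of "-1/2" 0 "real CARD('p)"] by (simp add: Suc_le_eq)
  then have "e * m * real CARD('p) powr (-1/2) \<le> e * m"
    using e0 m by (intro mult_left_le) auto
  moreover have "- c * lambda_bar Dstar = e * m" using l by (simp add: c_def l_def)
  ultimately have cl: "- c * lambda_bar Dstar * real CARD('p) powr (-1/2) \<le> e * m" by simp
  have em: "e * m \<le> e" using e0 m by (simp add: mult_left_le)
  show ?thesis
  proof (intro exI[of _ c] conjI[OF c] allI impI)
    fix A :: "real^'p^'p" and B :: "real^'q^'p"
    assume A: "op_norm (A - Astar) \<le> - c * lambda_bar Dstar * real CARD('p) powr (-1/2)"
      and B: "feedback Q R Astar Bstar \<noteq> 0 \<longrightarrow>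
        op_norm (B - Bstar) \<le> - c * lambda_bar Dstar * real CARD('p) powr (-1/2)
          * inverse (op_norm (feedback Q R Astar Bstar))"
    have B1: "op_norm (B - Bstar) * op_norm L \<le> e * m" if "L \<noteq> 0"
    proof -
      have "op_norm (B - Bstar)
          \<le> - c * lambda_bar Dstar * real CARD('p) powr (-1/2) * inverse (op_norm L)"
        using B that by (simp only: L_def not_False_eq_True simp_thms)
      also have "\<dots> \<le> e * m * inverse (op_norm L)"
        by (rule mult_right_mono[OF cl]) (simp add: op_norm_nonneg)
      finally show ?thesis using op_norm_pos[OF that] by (simp add: field_simps)
    qed
    show "feedback_well_defined Q R A B \<and> lambda_bar (Astar + Bstar ** feedback Q R A B) < 0"
    proof (rule e[rule_format])
      fix v :: "real^'p"
      have "op_norm (A - Astar) \<le> e" using A cl em by linarith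
      then show "norm ((A - Astar) *v v) \<le> e * norm v"
        by (intro order_trans[OF norm_le_op_norm] mult_right_mono) auto
    next
      fix v :: "real^'p"
      show "norm ((B - Bstar) *v (L *v v)) \<le> e * norm v"
      proof (cases "L = 0")
        case False
        have "norm ((B - Bstar) *v (L *v v)) \<le> op_norm (B - Bstar) * (op_norm L * norm v)"
          by (intro order_trans[OF norm_le_op_norm] mult_left_mono norm_le_op_norm op_norm_nonneg)
        also have "\<dots> = (op_norm (B - Bstar) * op_norm L) * norm v" by simp
        also have "\<dots> \<le> e * norm v" using B1[OF False] em by (intro mult_right_mono) auto
        finally show ?thesis .
      qed (use e0 in simp)
    next
      fix w :: "real^'q" assume L: "L \<noteq> 0"
      have "op_norm (B - Bstar) * op_norm L \<le> e * op_norm L"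
        using B1[OF L] mult_left_mono[OF m(3)[OF L], of e] e0 by linarith
      then have "op_norm (B - Bstar) \<le> e" using op_norm_pos[OF L] by simp
      then show "norm ((B - Bstar) *v w) \<le> e * norm w"
        by (intro order_trans[OF norm_le_op_norm] mult_right_mono) auto
    qed
  qed
qed

end
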